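(* Let $\beta=\frac{1+\sqrt5}{2}$. The Bernoulli convolution $\nu_\beta$ is singular with respect to Lebesgue measure, and its Hausdorff dimension satisfies \[ \dim_H(\nu_\beta)\le\dim_H\left(A_{5/18}\right)<1 . \]
   Context: $\beta=\frac{1+\sqrt5}{2}$ is the golden mean and $I_\beta=[0,\frac1{\beta-1}]$. Let $\Sigma=\{0,1\}^{\mathbb N}$ (indices $n\ge 1$), let $m$ be the $(\frac12,\frac12)$ Bernoulli (product) measure on $\Sigma$, and let $\pi:\Sigma\to I_\beta$, $\pi(\underline a)=\sum_{i=1}^\infty a_i\beta^{-i}$. The Bernoulli convolution is the pushforward probability measure $\nu_\beta=m\circ\pi^{-1}$ on $I_\beta$. The greedy $\beta$-transformation $T:I_\beta\to I_\beta$ is $T(x)=\beta x$ for $x\in[0,\frac1\beta)$ and $T(x)=\beta x-1$ for $x\in[\frac1\beta,\frac1{\beta-1}]$. The greedy $\beta$-expansion of $x\in I_\beta$ is the sequence $(x_n)_{n\ge1}\in\Sigma$ with $x_n=0$ if $T^{n-1}(x)\in[0,\frac1\beta)$ and $x_n=1$ if $T^{n-1}(x)\in[\frac1\beta,\frac1{\beta-1}]$; it satisfies $\sum_{n\ge1}x_n\beta^{-n}=x$. For $\gamma\in[0,1]$, $A_\gamma$ is the set of $x\in I_\beta$ whose greedy $\beta$-expansion $(x_n)$ has digit $1$ with frequency $\gamma$, i.e. $\lim_{n\to\infty}\frac1n\sum_{k=1}^nx_k=\gamma$. For sets, $\dim_H$ is Hausdorff dimension; for a probability measure $\nu$ on $I_\beta$,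 $\dim_H(\nu)=\inf\{\dim_H(A): A\subset I_\beta\text{ Borel},\ \nu(A)=1\}$. *)

theory Defs
  imports "HOL-Probability.Probability"
begin

section \<open>Hausdorff measure and dimension\<close>

text \<open>
  The guard on \<open>s = 0\<close> is needed because \<open>0 powr 0 = 0\<close>, whereas a nonempty set of
  diameter \<open>0\<close> has to count as \<open>1\<close> in the \<open>0\<close>-dimensional measure.
\<close>
definition diam_pow :: "real \<Rightarrow> 'a::metric_space set \<Rightarrow> ennreal" where
  "diam_pow s U = (if U = {} then 0 else if s = 0 then 1 else ennreal (diameter U powr s))"

text \<open>Boundedness is explicit because \<^const>\<open>diameter\<close> is only meaningful for bounded sets.\<close>
definition fine_covers :: "real \<Rightarrow> 'a::metric_space set \<Rightarrow> (nat \<Rightarrow> 'a set) set" where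
  "fine_covers \<delta> A = {U. A \<subseteq> (\<Union>n. U n) \<and> (\<forall>n. bounded (U n) \<and> diameter (U n) \<le> \<delta>)}"

definition hausdorff_premeasure :: "real \<Rightarrow> real \<Rightarrow> 'a::metric_space set \<Rightarrow> ennreal" where
  "hausdorff_premeasure \<delta> s A = (INF U \<in> fine_covers \<delta> A. \<Sum>n. diam_pow s (U n))"

definition hausdorff_measure :: "real \<Rightarrow> 'a::metric_space set \<Rightarrow> ennreal" where
  "hausdorff_measure s A = (SUP \<delta> \<in> {0<..}. hausdorff_premeasure \<delta> s A)"

definition hausdorff_dim :: "'a::metric_space set \<Rightarrow> ennreal" where
  "hausdorff_dim A = (INF s \<in> {s. 0 \<le> s \<and> hausdorff_measure s A = 0}. ennreal s)"

definition hausdorff_dim_measure :: "'a::metric_space set \<Rightarrow> 'a measure \<Rightarrow> ennreal" where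
  "hausdorff_dim_measure X \<nu> =
     (INF A \<in> {A. A \<subseteq> X \<and> A \<in> sets borel \<and> emeasure \<nu> A = 1}. hausdorff_dim A)"

section \<open>Singular measures\<close>

definition mutually_singular :: "'a measure \<Rightarrow> 'a measure \<Rightarrow> bool" where
  "mutually_singular M N \<longleftrightarrow> sets M = sets N \<and>
     (\<exists>A \<in> sets M. emeasure M A = 0 \<and> emeasure N (space N - A) = 0)"

section \<open>Bernoulli convolutions\<close>

definition I_beta :: "real \<Rightarrow> real set" where
  "I_beta \<beta> = {0..1 / (\<beta> - 1)}"

text \<open>
  Digit sequences are indexed by \<open>n \<ge> 1\<close>: the underlying space of the product measure is
  the set of extensional functions from \<open>{1..}\<close> to \<open>{0, 1}\<close>.
\<close>
definition coin_measure :: "(nat \<Rightarrow> nat) measure" where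
  "coin_measure = PiM {1..} (\<lambda>_. uniform_count_measure {0, 1})"

definition beta_value :: "real \<Rightarrow> (nat \<Rightarrow> nat) \<Rightarrow> real" where
  "beta_value \<beta> a = (\<Sum>i. real (a (Suc i)) / \<beta> ^ Suc i)"

definition bernoulli_convolution :: "real \<Rightarrow> real measure" where
  "bernoulli_convolution \<beta> = distr coin_measure borel (beta_value \<beta>)"

lemma space_coin_measure: "space coin_measure = {1..} \<rightarrow>\<^sub>E {0, 1}"
  by (simp add: coin_measure_def space_PiM space_uniform_count_measure)

lemma prob_space_coin_measure: "prob_space coin_measure"
  unfolding coin_measure_def
  by (intro prob_space_PiM prob_space_uniform_count_measure) auto

lemma measurable_beta_value [measurable]: "beta_value \<beta> \<in> borel_measurable coin_measure"
proof -
  have "(\<lambda>a. real (a (Suc i))) \<in> borel_measurable coin_measure" for i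
  proof -
    have "(\<lambda>a. a (Suc i)) \<in> coin_measure \<rightarrow>\<^sub>M uniform_count_measure {0, 1}"
      unfolding coin_measure_def by (rule measurable_component_singleton) simp
    moreover have "real \<in> borel_measurable (uniform_count_measure {0, 1})"
      by (auto simp: measurable_def sets_uniform_count_measure space_uniform_count_measure)
    ultimately show ?thesis
      by (rule measurable_compose)
  qed
  then show ?thesis
    unfolding beta_value_def by measurable
qed

lemma prob_space_bernoulli_convolution: "prob_space (bernoulli_convolution \<beta>)"
  unfolding bernoulli_convolution_def
  by (intro prob_space.prob_space_distr prob_space_coin_measure measurable_beta_value)

lemma sets_bernoulli_convolution [simp]: "sets (bernoulli_convolution \<beta>) = sets borel"
  by (simp add: bernoulli_convolution_def)

section \<open>Greedy expansions and digit frequencies\<close>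

definition greedy_map :: "real \<Rightarrow> real \<Rightarrow> real" where
  "greedy_map \<beta> x = (if x < 1 / \<beta> then \<beta> * x else \<beta> * x - 1)"

text \<open>Only the digits with index \<open>n \<ge> 1\<close>, at points \<open>x \<in> I_beta \<beta>\<close>, are meaningful.\<close>
definition greedy_digit :: "real \<Rightarrow> real \<Rightarrow> nat \<Rightarrow> nat" where
  "greedy_digit \<beta> x n = (if (greedy_map \<beta> ^^ (n - 1)) x < 1 / \<beta> then 0 else 1)"

definition digit_freq_set :: "real \<Rightarrow> real \<Rightarrow> real set" where
  "digit_freq_set \<beta> \<gamma> = {x \<in> I_beta \<beta>.
     (\<lambda>n. (\<Sum>k = 1..n. real (greedy_digit \<beta> x k)) / real n) \<longlonglongrightarrow> \<gamma>}"

end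

theory Submission
  imports Defs
begin

text \<open>
  Reading fair coin tosses from left to right and replacing \<open>011\<close> by \<open>100\<close> gives the greedy
  digits up to a pending alternating block \<open>0(10)\<^sup>k\<close>, so the digits and the block form a Markov
  chain. Its additive functional counting ones has drift \<open>5/18\<close>; a quadratic Lyapunov function
  bounds its variance linearly in time, and Borel-Cantelli along the times \<open>m\<^sup>4\<close> together with
  monotonicity gives the frequency \<open>5/18\<close> almost surely.

  The frequency of ones maximising the entropy of golden mean words is \<open>1 / (\<phi> \<surd>5) < 5/18\<close>.
  Hence a Chernoff bound shows that only \<open>O(q\<^sup>n)\<close>, \<open>q < \<phi>\<close>, of the \<open>n\<close>-cylinders have about
  \<open>5n/18\<close> ones, and covering by these cylinders for all \<open>n \<ge> N\<close> bounds the dimension.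
\<close>

section \<open>Arithmetic of the golden mean\<close>

definition golden :: real ("\<phi>")
  where "\<phi> = (1 + sqrt 5) / 2"

lemma golden_square: "\<phi> * \<phi> = \<phi> + 1"
proof -
  have "sqrt 5 * sqrt 5 = (5::real)" by simp
  then show ?thesis unfolding golden_def by (simp add: field_simps)
qed

lemma golden_mult: "\<phi> * (\<phi> * x) = \<phi> * x + x"
  using golden_square by (simp add: mult.assoc[symmetric] distrib_right)

lemma golden_bounds: "1.6 < \<phi>" "\<phi> < 1.7"
proof -
  have "2.2 < sqrt 5" by (rule real_less_rsqrt) (simp add: power2_eq_square)
  moreover have "sqrt 5 < 2.4" by (rule real_less_lsqrt) (simp_all add: power2_eq_square)
  ultimately show "1.6 < \<phi>" "\<phi> < 1.7" by (simp_all add: golden_def)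
qed

lemma golden_pos [simp]: "0 < \<phi>" "0 \<le> \<phi>" "\<phi> \<noteq> 0" "1 < \<phi>" "1 \<le> \<phi>"
  using golden_bounds by auto

lemma inverse_golden: "1 / \<phi> = \<phi> - 1"
  using golden_square by (simp add: field_simps)

lemma inverse_golden_minus_one: "1 / (\<phi> - 1) = \<phi>"
  using golden_square golden_bounds by (simp add: field_simps)

lemma I_beta_golden: "I_beta \<phi> = {0..\<phi>}"
  by (simp add: I_beta_def inverse_golden_minus_one)

section \<open>Digit counts\<close>

abbreviation "T \<equiv> greedy_map \<phi>"

lemma T_low: "x < \<phi> - 1 \<Longrightarrow> T x = \<phi> * x"
  by (simp add: greedy_map_def inverse_golden)

lemma T_high: "\<phi> - 1 \<le> x \<Longrightarrow> T x = \<phi> * x - 1"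
  by (simp add: greedy_map_def inverse_golden)

definition ones :: "nat \<Rightarrow> real \<Rightarrow> nat"
  where "ones n x = (\<Sum>k = 1..n. greedy_digit \<phi> x k)"

lemma ones_0 [simp]: "ones 0 x = 0"
  by (simp add: ones_def)

lemma ones_Suc: "ones (Suc n) x = (if x < \<phi> - 1 then 0 else 1) + ones n (T x)"
proof -
  have "ones (Suc n) x = greedy_digit \<phi> x 1 + (\<Sum>k = 1..n. greedy_digit \<phi> x (Suc k))"
    unfolding ones_def by (subst sum.atLeast_Suc_atMost)
      (simp_all add: sum.atLeast_Suc_atMost_Suc_shift del: sum.cl_ivl_Suc)
  also have "(\<Sum>k = 1..n. greedy_digit \<phi> x (Suc k)) = (\<Sum>k = 1..n. greedy_digit \<phi> (T x) k)"
  proof (rule sum.cong)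
    fix k assume "k \<in> {1..n}"
    then obtain j where "k = Suc j" by (cases k) auto
    then show "greedy_digit \<phi> x (Suc k) = greedy_digit \<phi> (T x) k"
      by (simp only: greedy_digit_def diff_Suc_1 funpow_Suc_right o_apply)
  qed simp
  finally show ?thesis by (simp add: ones_def greedy_digit_def inverse_golden)
qed

lemma ones_add: "ones (m + n) x = ones m x + ones n ((T ^^ m) x)"
  by (induction m arbitrary: x) (simp_all add: ones_Suc funpow_swap1)

lemma ones_le: "ones n x \<le> n"
  by (induction n arbitrary: x) (simp_all add: ones_Suc le_SucI)

lemma ones_mono: "m \<le> n \<Longrightarrow> ones m x \<le> ones n x"
  by (metis le_add1 le_add_diff_inverse ones_add)

section \<open>Digit frequency along greedy orbits\<close>

definition has_freq :: "real \<Rightarrow> real \<Rightarrow> bool"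
  where "has_freq \<gamma> x \<longleftrightarrow> (\<lambda>n. real (ones n x) / real n) \<longlonglongrightarrow> \<gamma>"

lemma digit_freq_set_golden: "digit_freq_set \<phi> \<gamma> = {x \<in> {0..\<phi>}. has_freq \<gamma> x}"
  unfolding digit_freq_set_def has_freq_def ones_def I_beta_golden by simp

text \<open>Prepending one digit moves an average over \<open>n\<close> places of numbers in [0, 1]
  by at most \<open>1 / (n + 1)\<close>.\<close>

lemma has_freq_T: "has_freq \<gamma> (T x) \<longleftrightarrow> has_freq \<gamma> x"
proof -
  define d :: real where "d = (if x < \<phi> - 1 then 0 else 1)"
  define f where "f n = real (ones n (T x)) / real n" for n
  define h where "h n = real (ones (Suc n) x) / real (Suc n)" for n
  have fh: "h n = (d + real n * f n) / (real n + 1)" for n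
    by (simp add: h_def f_def ones_Suc d_def add_ac)
  have "(\<lambda>n. h n - f n) \<longlonglongrightarrow> 0"
  proof (rule tendsto_sandwich[where f="\<lambda>n. - 1 / (real n + 1)" and h="\<lambda>n. 1 / (real n + 1)"])
    have f01: "0 \<le> f n" "f n \<le> 1" for n
      using ones_le[of n "T x"] by (auto simp: f_def field_simps divide_le_eq_1)
    have eq: "h n - f n = (d - f n) / (real n + 1)" for n
      unfolding fh by (simp add: field_simps)
    have "d \<in> {0..1}" by (simp add: d_def)
    then show "\<forall>\<^sub>F n in sequentially. - 1 / (real n + 1) \<le> h n - f n"
      and "\<forall>\<^sub>F n in sequentially. h n - f n \<le> 1 / (real n + 1)"
      unfolding eq using f01 by (auto intro!: always_eventually divide_right_mono simp del: minus_divide_left[symmetric])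
         (smt (verit) f01)+
  qed real_asymp+
  then have "h \<longlonglongrightarrow> \<gamma> \<longleftrightarrow> f \<longlonglongrightarrow> \<gamma>"
    by (metis Lim_transform Lim_transform2)
  moreover have "h \<longlonglongrightarrow> \<gamma> \<longleftrightarrow> has_freq \<gamma> x"
    unfolding h_def has_freq_def by (rule filterlim_sequentially_Suc)
  ultimately show ?thesis unfolding f_def has_freq_def by simp
qed

lemma has_freq_funpow: "has_freq \<gamma> ((T ^^ m) x) \<longleftrightarrow> has_freq \<gamma> x"
  by (induction m) (simp_all add: has_freq_T)

text \<open>After every two steps the gap between the orbits is 0 or 1 again. While it is 1, the
  upper point stays in [1, \<phi>), yet its distance to the fixed point \<phi> grows by the factor
  \<open>\<phi> ^ 2\<close>, so the gap must close.\<close>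

lemma orbits_merge:
  assumes "1 \<le> x" "x < \<phi>"
  shows "\<exists>m. (T ^^ m) x = (T ^^ m) (x - 1)"
proof -
  have step: "(\<exists>m. (T ^^ m) x = (T ^^ m) (x - 1)) \<or>
      (1 \<le> (T ^^ 2) x \<and> (T ^^ 2) (x - 1) = (T ^^ 2) x - 1 \<and> \<phi> - (T ^^ 2) x = \<phi> ^ 2 * (\<phi> - x))"
    if x: "1 \<le> x" "x < \<phi>" for x
  proof -
    have 1: "T x = \<phi> * x - 1" "T (x - 1) = \<phi> * x - \<phi>"
      using x golden_bounds by (auto simp: T_high T_low algebra_simps)
    have "\<phi> * 1 \<le> \<phi> * x" using x by (intro mult_left_mono) auto
    then have 2: "(T ^^ 2) x = \<phi> * (\<phi> * x - 1) - 1"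
      by (simp add: numeral_2_eq_2 1 T_high)
    have 3: "\<phi> - (T ^^ 2) x = \<phi> ^ 2 * (\<phi> - x)"
      unfolding 2 by (simp add: power2_eq_square golden_mult golden_square algebra_simps)
    \<comment> \<open>The gap after one step is \<open>\<phi> - 1\<close>. The second digit of
      \<open>x\<close> is 1, so after two steps the gap is \<open>\<phi> * (\<phi> - 1) - 1\<close>
      plus the second digit of \<open>x - 1\<close>, that is, just this digit.\<close>
    show ?thesis
    proof (cases "\<phi> * x - \<phi> < \<phi> - 1")
      case True
      then have "(T ^^ 2) (x - 1) = (T ^^ 2) x"
        using golden_square unfolding 2 by (simp add: numeral_2_eq_2 1 T_low algebra_simps)
      then show ?thesis by metis
    next
      case False
      then have *: "(T ^^ 2) (x - 1) = (T ^^ 2) x - 1"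
        using golden_square unfolding 2 by (simp add: numeral_2_eq_2 1 T_high algebra_simps)
      have "\<phi> * (\<phi> - 1) \<le> \<phi> * (\<phi> * x - \<phi>)"
        using False by (intro mult_left_mono) auto
      then have "1 \<le> (T ^^ 2) x"
        unfolding 2 using golden_square by (simp add: algebra_simps)
      with * 3 show ?thesis by blast
    qed
  qed
  \<comment> \<open>\<open>N\<close> bounds the number of double steps: each divides
    \<open>1 / (\<phi> - x)\<close> by \<open>\<phi> ^ 2\<close>, and for \<open>N = 0\<close> the
    bound contradicts \<open>1 \<le> x\<close>.\<close>
  obtain N :: nat where N: "1 / (\<phi> - x) < (\<phi> ^ 2) ^ N"
    using real_arch_pow[of "\<phi> ^ 2"] by auto
  show ?thesis using assms N
  proof (induction N arbitrary: x)
    case 0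
    then show ?case using golden_bounds by (auto simp: field_simps)
  next
    case (Suc N)
    define z where "z = (T ^^ 2) x"
    from step[OF Suc.prems(1,2)] show ?case
    proof
      assume *: "1 \<le> (T ^^ 2) x \<and> (T ^^ 2) (x - 1) = (T ^^ 2) x - 1 \<and> \<phi> - (T ^^ 2) x = \<phi> ^ 2 * (\<phi> - x)"
      then have zx: "1 \<le> z" "(T ^^ 2) (x - 1) = z - 1" "\<phi> - z = \<phi> ^ 2 * (\<phi> - x)"
        by (simp_all add: z_def)
      have pos: "0 < \<phi> ^ 2 * (\<phi> - x)" using Suc.prems by simp
      then have "z < \<phi>" using zx(3) by linarith
      moreover have "1 / (\<phi> - z) < (\<phi> ^ 2) ^ N"
        unfolding zx(3) using Suc.prems(2,3) by (simp add: field_simps)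
      ultimately obtain m where "(T ^^ m) z = (T ^^ m) (z - 1)"
        using Suc.IH zx(1) by blast
      then have "(T ^^ (m + 2)) x = (T ^^ (m + 2)) (x - 1)"
        by (simp only: funpow_add o_apply zx(2) z_def[symmetric])
      then show ?thesis by blast
    qed
  qed
qed

lemma has_freq_minus_one:
  assumes "1 \<le> x" "x < \<phi>"
  shows "has_freq \<gamma> (x - 1) \<longleftrightarrow> has_freq \<gamma> x"
  using orbits_merge[OF assms] has_freq_funpow by metis

text \<open>The fixed point \<phi> has only digits 1. This keeps it, the one point of
  \<open>{1..\<phi>}\<close> outside the scope of \<open>orbits_merge\<close>, out of the frequency
  sets with \<gamma> other than 1.\<close>

lemma has_freq_golden: "has_freq 1 \<phi>"
proof -
  have "T \<phi> = \<phi>" using golden_square by (subst T_high) auto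
  then have "ones n \<phi> = n" for n
    by (induction n) (simp_all add: ones_Suc)
  then have "\<forall>\<^sub>F n in sequentially. real (ones n \<phi>) / real n = 1"
    by (auto intro: eventually_sequentiallyI[of 1])
  then show ?thesis unfolding has_freq_def by (rule tendsto_eventually)
qed

section \<open>Normalising a digit sequence\<close>

text \<open>\<open>t\<close> is the value of whatever follows \<open>v\<close>. Nested divisions
  instead of a sum of powers turn appending words into composing maps.\<close>

definition word_val :: "nat list \<Rightarrow> real \<Rightarrow> real"
  where "word_val v t = foldr (\<lambda>d y. (real d + y) / \<phi>) v t"

lemma word_val_simps [simp]:
  "word_val [] t = t"
  "word_val (d # v) t = (real d + word_val v t) / \<phi>"
  "word_val (u @ v) t = word_val u (word_val v t)"
  by (simp_all add: word_val_def)

text \<open>A digit 1 is allowed only before a value below \<open>1 / \<phi>\<close>, whose greedy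
  digit is 0. This makes \<open>v\<close> the greedy word of its value, with greedy remainder
  \<open>t\<close>.\<close>

fun admissible :: "nat list \<Rightarrow> real \<Rightarrow> bool" where
  "admissible [] t \<longleftrightarrow> 0 \<le> t \<and> t < 1"
| "admissible (d # v) t \<longleftrightarrow> admissible v t \<and> (d = 0 \<or> d = 1 \<and> word_val v t < 1 / \<phi>)"

lemma admissible_bounds: "admissible v t \<Longrightarrow> 0 \<le> word_val v t \<and> word_val v t < 1"
proof (induction v)
  case (Cons d v)
  then have IH: "0 \<le> word_val v t" "word_val v t < 1" by auto
  show ?case
  proof (cases "d = 0")
    case True
    with IH golden_bounds show ?thesis by (simp add: field_simps)
  next
    case False
    with Cons.prems have "d = 1" "word_val v t < \<phi> - 1" by (auto simp: inverse_golden)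
    with IH golden_bounds show ?thesis by (simp add: field_simps)
  qed
qed simp

lemma admissible_greedy:
  "admissible v t \<Longrightarrow> (T ^^ length v) (word_val v t) = t \<and> ones (length v) (word_val v t) = sum_list v"
proof (induction v)
  case (Cons d v)
  have b: "0 \<le> word_val v t" "word_val v t < 1"
    using admissible_bounds Cons.prems by auto
  have *: "T (word_val (d # v) t) = word_val v t \<and>
      (if word_val (d # v) t < \<phi> - 1 then 0 else 1) = d"
  proof (cases "d = 0")
    case True
    then have "word_val (d # v) t < 1 / \<phi>" using b by (simp add: divide_strict_right_mono)
    with True show ?thesis by (simp add: inverse_golden T_low)
  next
    case False
    with Cons.prems have "d = 1" by simp
    moreover have "1 / \<phi> \<le> (1 + word_val v t) / \<phi>"
      using b by (intro divide_right_mono) auto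
    ultimately show ?thesis by (simp add: inverse_golden T_high)
  qed
  then show ?case using Cons
    by (simp add: funpow_Suc_right ones_Suc del: funpow.simps)
qed simp

fun alt :: "nat \<Rightarrow> nat list" where
  "alt 0 = [0]"
| "alt (Suc k) = 0 # 1 # alt k"

lemma length_alt [simp]: "length (alt k) = 2 * k + 1"
  by (induction k) auto

lemma sum_list_alt [simp]: "sum_list (alt k) = k"
  by (induction k) auto

lemma alt_snoc: "alt (Suc k) = alt k @ [1, 0]"
  by (induction k) auto

text \<open>The carry through a whole block, from \<open>0(10)^k 11\<close> to
  \<open>1 0^(2k+2)\<close>: each replacement of 011 by 100 produces the last 1 of another 011 two
  places to the left.\<close>

lemma word_val_alt_carry: "word_val (alt k) ((1 + (1 + t) / \<phi>) / \<phi>) = word_val (1 # replicate (2 * k + 2) 0) t"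
proof -
  have *: "(((1 + (1 + t) / \<phi>) / \<phi>) / \<phi>) = (1 + t / \<phi> / \<phi>) / \<phi>" for t
  proof -
    have "\<phi> * ((1 + (1 + t) / \<phi>) / \<phi> / \<phi>) = (\<phi> + 1 + t) / (\<phi> * \<phi>)" by (simp add: field_simps)
    also have "\<dots> = 1 + t / \<phi> / \<phi>"
      unfolding golden_square[symmetric] by (simp add: field_simps)
    finally show ?thesis by (simp add: eq_divide_eq mult.commute)
  qed
  show ?thesis by (induction k) (simp_all add: * del: divide_divide_eq_left)
qed

lemma admissible_replicate_0: "0 \<le> t \<Longrightarrow> t < 1 \<Longrightarrow> admissible (replicate n 0) t"
  by (induction n) auto

text \<open>The bound by \<open>1 / \<phi>\<close> travels with the induction because it permits the
  1 that is put in front next.\<close>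

lemma admissible_alt:
  assumes "0 \<le> t" "t < 1"
  shows "admissible (alt k) t \<and> word_val (alt k) t < 1 / \<phi>"
proof (induction k)
  case 0
  show ?case using assms by (simp add: divide_strict_right_mono)
next
  case (Suc k)
  then have "admissible (1 # alt k) t" by simp
  moreover from admissible_bounds[OF this] have "word_val (0 # 1 # alt k) t < 1 / \<phi>"
    by (simp only: word_val_simps of_nat_0 add_0) (rule divide_strict_right_mono, auto)
  ultimately show ?case by simp
qed

lemma admissible_carry:
  assumes "0 \<le> t" "t < 1"
  shows "admissible (1 # replicate (Suc n) 0) t"
  using admissible_replicate_0[OF assms, of n] admissible_bounds[of "replicate n 0" t]
  by (simp add: divide_strict_right_mono)

text \<open>
  A state \<open>(q, k, c)\<close>: normalising (\<open>011 \<rightarrow> 100\<close>) the digits read so far gives a word whose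
  last digits \<open>0(10)\<^sup>k\<close>, followed by \<open>1\<close> if \<open>q\<close>, may still be changed by a carry, while
  the digits before them are final and contain \<open>c\<close> ones.
\<close>
type_synonym state = "bool \<times> nat \<times> nat"

text \<open>A 0 after \<open>0(10)^k\<close> stops every later carry, so the block becomes final and
  the new 0 opens the next one; \<open>10\<close> lengthens the block. A second 1 carries, giving
  \<open>1 0^(2k+2)\<close>: one 1 becomes final and the last 0 is the new block.\<close>

fun step :: "state \<Rightarrow> nat \<Rightarrow> state" where
  "step (False, k, c) d = (if d = 0 then (False, 0, c + k) else (True, k, c))"
| "step (True, k, c) d = (if d = 0 then (False, Suc k, c) else (False, 0, Suc c))"

text \<open>The start state already has the pending word \<open>[0]\<close>: a 0 is put before the
  digits so that a carry past the first digit has room. Hence the division by \<phi> and the lengths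
  \<open>Suc n\<close> below.\<close>

definition run :: "nat list \<Rightarrow> state"
  where "run w = foldl step (False, 0, 0) w"

lemma run_Nil [simp]: "run [] = (False, 0, 0)"
  and run_snoc [simp]: "run (w @ [d]) = step (run w) d"
  by (simp_all add: run_def)

fun pending :: "state \<Rightarrow> nat list" where
  "pending (q, k, c) = alt k @ (if q then [1] else [])"

fun committed :: "state \<Rightarrow> nat" where
  "committed (q, k, c) = c"

definition prefix :: "(nat \<Rightarrow> nat) \<Rightarrow> nat \<Rightarrow> nat list"
  where "prefix a n = map a [1..<Suc n]"

lemma prefix_0 [simp]: "prefix a 0 = []"
  and prefix_Suc [simp]: "prefix a (Suc n) = prefix a n @ [a (Suc n)]"
  and length_prefix [simp]: "length (prefix a n) = n"
  by (simp_all add: prefix_def)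

text \<open>\<open>t\<close> is the value of the unread digits, \<open>y\<close> that of the whole
  sequence behind the extra 0. The final digits are not stored; reaching the pending word from
  \<open>y\<close> in \<open>l\<close> greedy steps says that they are greedy.\<close>

definition normalises :: "real \<Rightarrow> real \<Rightarrow> nat \<Rightarrow> state \<Rightarrow> bool" where
  "normalises y t n s \<longleftrightarrow> (\<exists>l. l + length (pending s) = Suc n \<and>
     (T ^^ l) y = word_val (pending s) t \<and> ones l y = committed s)"

text \<open>Here \<open>u\<close> becomes final and one 0 stays pending; \<open>t / \<phi>\<close>
  is the value of that 0 followed by \<open>t\<close>.\<close>

lemma normalises_commit:
  assumes l: "l + Suc (length u) = Suc (Suc n)"
    and y: "(T ^^ l) y = word_val u (t / \<phi>)" and c: "ones l y = c"
    and t: "admissible u (t / \<phi>)"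
  shows "normalises y t (Suc n) (False, 0, c + sum_list u)"
  unfolding normalises_def
proof (intro exI conjI)
  show "length u + l + length (pending (False, 0, c + sum_list u)) = Suc (Suc n)"
    using l by simp
  show "(T ^^ (length u + l)) y = word_val (pending (False, 0, c + sum_list u)) t"
    using admissible_greedy[OF t] by (simp add: funpow_add y)
  show "ones (length u + l) y = committed (False, 0, c + sum_list u)"
    using admissible_greedy[OF t] ones_add[of l "length u" y] by (simp add: y c add.commute)
qed

lemma normalises_step:
  assumes "normalises y ((real d + t) / \<phi>) n s" "d \<in> {0, 1}" "0 \<le> t" "t < \<phi>"
  shows "normalises y t (Suc n) (step s d)"
proof -
  obtain q k c where s: "s = (q, k, c)" by (cases s) auto
  obtain l where l: "l + length (pending s) = Suc n"
    "(T ^^ l) y = word_val (pending s) ((real d + t) / \<phi>)" "ones l y = c"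
    using assms(1) by (auto simp: normalises_def s)
  \<comment> \<open>An unread tail may have value 1 or more; behind a 0 its value is divided by
    \<phi> and falls into the range that \<open>admissible\<close> requires.\<close>
  have t: "0 \<le> t / \<phi>" "t / \<phi> < 1" using assms by simp_all
  consider "\<not> q" "d = 0" | "\<not> q" "d = 1" | "q" "d = 0" | "q" "d = 1"
    using assms(2) by auto
  then show ?thesis
  proof cases
    case 1
    with s l have "normalises y t (Suc n) (False, 0, c + sum_list (alt k))"
      by (intro normalises_commit[of l]) (use admissible_alt[OF t] in auto)
    then show ?thesis using 1 by (simp add: s)
  next
    case 2
    then show ?thesis using s l by (auto simp: normalises_def)
  next
    case 3
    have "pending (step s d) = pending s @ [0]"
      using 3 alt_snoc[of k] by (simp add: s del: alt.simps)
    then show ?thesis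
      unfolding normalises_def using 3 s l by (intro exI[of _ l]) auto
  next
    case 4
    \<comment> \<open>The last 0 of \<open>1 0^(2k+2)\<close> is split off as the new pending
      block.\<close>
    have rep: "replicate (2 * k + 2) 0 = replicate (Suc (2 * k)) 0 @ [0::nat]"
      by (simp add: replicate_append_same)
    have "(T ^^ l) y = word_val (1 # replicate (Suc (2 * k)) 0) (t / \<phi>)"
      using 4 s l(2) word_val_alt_carry[of k t] unfolding rep by simp
    with 4 s l have "normalises y t (Suc n) (False, 0, c + sum_list (1 # replicate (Suc (2 * k)) 0))"
      by (intro normalises_commit[of l]) (use admissible_carry[OF t, of "2 * k"] in auto)
    then show ?thesis using 4 by (simp add: s sum_list_replicate)
  qed
qed

lemma normalises_run:
  assumes "\<And>n. a (Suc n) \<in> {0, 1}" "\<And>n. 0 \<le> r n" "\<And>n. r n < \<phi>"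
    and "\<And>n. r n = (real (a (Suc n)) + r (Suc n)) / \<phi>"
  shows "normalises (r 0 / \<phi>) (r n) n (run (prefix a n))"
proof (induction n)
  case 0
  show ?case by (simp add: normalises_def)
next
  case (Suc n)
  then have "normalises (r 0 / \<phi>) (r (Suc n)) (Suc n) (step (run (prefix a n)) (a (Suc n)))"
    by (intro normalises_step[OF _ assms(1,2,3)]) (simp only: assms(4)[of n, symmetric])
  then show ?case by simp
qed

text \<open>The pending word is nonempty, so at most \<open>n\<close> digits are final; together
  with the pending ones they number at least \<open>n\<close>.\<close>

lemma normalises_ones:
  assumes "normalises y t n s"
  shows "committed s \<le> ones n y" "ones n y \<le> committed s + length (pending s)"
proof -
  obtain l where l: "l + length (pending s) = Suc n" "ones l y = committed s"
    using assms by (auto simp: normalises_def)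
  have p: "length (pending s) > 0" by (cases s) auto
  show "committed s \<le> ones n y"
    unfolding l(2)[symmetric] by (rule ones_mono) (use l(1) p in linarith)
  have "n \<le> l + length (pending s)" using l by simp
  then have "ones n y \<le> ones l y + ones (length (pending s)) ((T ^^ l) y)"
    by (metis ones_add ones_mono)
  then show "ones n y \<le> committed s + length (pending s)"
    using ones_le[of "length (pending s)" "(T ^^ l) y"] l by linarith
qed

section \<open>Second moments\<close>

text \<open>
  The compensator makes \<open>committed + compensator - 5/18 n\<close> a martingale under fair coin tosses;
  this is where the frequency \<open>5/18\<close> comes from. The Lyapunov function dominates the variance of
  its increments.
\<close>
fun compensator :: "state \<Rightarrow> real" where
  "compensator (False, k, c) = 2 / 3 * real k"
| "compensator (True, k, c) = real k / 3 + 5 / 9"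

fun lyapunov :: "state \<Rightarrow> real" where
  "lyapunov (False, k, c) = (real k)\<^sup>2"
| "lyapunov (True, k, c) = 11 / 18 * (real k + 1)\<^sup>2"

definition energy :: "nat \<Rightarrow> state \<Rightarrow> real" where
  "energy n s = (real (committed s) + compensator s - 5 / 18 * real n)\<^sup>2 + lyapunov s"

lemma energy_eqI:
  "real (committed s) + compensator s - 5 / 18 * real n = u \<Longrightarrow> energy n s = u\<^sup>2 + lyapunov s"
  by (simp add: energy_def)

lemma energy_step:
  "energy (Suc n) (step s 0) + energy (Suc n) (step s 1) \<le> 2 * (energy n s + 1)"
proof -
  obtain q k c where s: "s = (q, k, c)" by (cases s) auto
  define x where "x = real c - 5 / 18 * real n"
  define z where "z = real k"
  show ?thesis
  proof (cases q)
    case False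
    \<comment> \<open>The martingale property cancels all terms in \<open>x\<close>; the rest is a
      positive quadratic in \<open>z\<close>, displayed through squares.\<close>
    have "2 * ((x + 2 / 3 * z)\<^sup>2 + z\<^sup>2 + 1) -
        ((x + z - 5/18)\<^sup>2 + ((x + (z / 3 + 5 / 9) - 5/18)\<^sup>2 + 11 / 18 * (z + 1)\<^sup>2)) =
        23 / 54 * (z - 1)\<^sup>2 + 20 / 27 * z\<^sup>2 + 131 / 162"
      by (simp add: power2_eq_square field_simps)
    moreover have "0 \<le> 23 / 54 * (z - 1)\<^sup>2 + 20 / 27 * z\<^sup>2 + 131 / 162"
      by (intro add_nonneg_nonneg) auto
    ultimately have "(x + z - 5/18)\<^sup>2 + ((x + (z / 3 + 5 / 9) - 5/18)\<^sup>2 + 11 / 18 * (z + 1)\<^sup>2) \<le>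
        2 * ((x + 2 / 3 * z)\<^sup>2 + z\<^sup>2 + 1)"
      by (metis diff_ge_0_iff_ge)
    moreover have "energy n s = (x + 2 / 3 * z)\<^sup>2 + z\<^sup>2"
      using False by (subst energy_eqI[of _ _ "x + 2 / 3 * z"]) (simp_all add: s x_def z_def)
    moreover have "energy (Suc n) (step s 0) = (x + z - 5/18)\<^sup>2"
      using False by (subst energy_eqI[of _ _ "x + z - 5/18"]) (simp_all add: s x_def z_def field_simps)
    moreover have "energy (Suc n) (step s 1) = (x + (z / 3 + 5 / 9) - 5/18)\<^sup>2 + 11 / 18 * (z + 1)\<^sup>2"
      using False by (subst energy_eqI[of _ _ "x + (z / 3 + 5 / 9) - 5/18"]) (simp_all add: s x_def z_def field_simps)
    ultimately show ?thesis by (simp only: add.assoc)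
  next
    case True
    \<comment> \<open>Besides the terms in \<open>x\<close>, the weight \<open>11 / 18\<close>
      cancels those in \<open>z^2\<close>, leaving a linear function of
      \<open>z \<ge> 0\<close>.\<close>
    have "2 * ((x + (z / 3 + 5 / 9))\<^sup>2 + 11 / 18 * (z + 1)\<^sup>2 + 1) -
        ((x + 2 / 3 * (1 + z) - 5/18)\<^sup>2 + (z + 1)\<^sup>2 + (x + 1 - 5/18)\<^sup>2) =
        2 / 3 * z + 13 / 6"
      by (simp add: power2_eq_square field_simps)
    moreover have "0 \<le> 2 / 3 * z + 13 / 6" by (simp add: z_def)
    ultimately have "(x + 2 / 3 * (1 + z) - 5/18)\<^sup>2 + (z + 1)\<^sup>2 + (x + 1 - 5/18)\<^sup>2 \<le>
        2 * ((x + (z / 3 + 5 / 9))\<^sup>2 + 11 / 18 * (z + 1)\<^sup>2 + 1)"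
      by (metis diff_ge_0_iff_ge)
    moreover have "energy n s = (x + (z / 3 + 5 / 9))\<^sup>2 + 11 / 18 * (z + 1)\<^sup>2"
      using True by (subst energy_eqI[of _ _ "x + (z / 3 + 5 / 9)"]) (simp_all add: s x_def z_def)
    moreover have "energy (Suc n) (step s 0) = (x + 2 / 3 * (1 + z) - 5/18)\<^sup>2 + (z + 1)\<^sup>2"
      using True by (subst energy_eqI[of _ _ "x + 2 / 3 * (1 + z) - 5/18"]) (simp_all add: s x_def z_def field_simps)
    moreover have "energy (Suc n) (step s 1) = (x + 1 - 5/18)\<^sup>2"
      using True by (subst energy_eqI[of _ _ "x + 1 - 5/18"]) (simp_all add: s x_def z_def field_simps)
    ultimately show ?thesis by (simp only:)
  qed
qed

lemma energy_nonneg: "0 \<le> energy n s"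
proof -
  obtain q k c where "s = (q, k, c)" by (cases s) auto
  then show ?thesis by (cases q) (auto simp: energy_def intro!: add_nonneg_nonneg mult_nonneg_nonneg)
qed

text \<open>The digit count differs from committed count plus compensator by O(k + 1), and
  \<open>lyapunov\<close> controls \<open>(k + 1)^2\<close>. The constants multiply to 2 * 9 * 2 =
  36, within the 72.\<close>

lemma ones_deviation:
  assumes "normalises y t n s"
  shows "(real (ones n y) - 5 / 18 * real n)\<^sup>2 \<le> 72 * (energy n s + 1)"
proof -
  obtain q k c where s: "s = (q, k, c)" by (cases s) auto
  define z M where "z = real k" and "M = real (committed s) + compensator s - 5 / 18 * real n"
  define D where "D = real (ones n y) - 5 / 18 * real n"
  have z: "0 \<le> z" by (simp add: z_def)
  have g: "0 \<le> compensator s" "compensator s \<le> z + 1"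
    by (cases q; simp add: s z_def)+
  have p: "real (length (pending s)) \<le> 2 * z + 2" by (simp add: s z_def)
  have "D - M = real (ones n y) - real (committed s) - compensator s"
    by (simp add: D_def M_def)
  then have "\<bar>D - M\<bar> \<le> 3 * (z + 1)"
    using normalises_ones[OF assms, THEN of_nat_mono[where 'a = real]] g p z
    unfolding of_nat_add by argo
  then have 1: "(D - M)\<^sup>2 \<le> (3 * (z + 1))\<^sup>2" by (metis abs_ge_zero power2_abs power_mono)
  have 2: "D\<^sup>2 \<le> 2 * M\<^sup>2 + 2 * (D - M)\<^sup>2"
    using zero_le_power2[of "D - 2 * M"] by (simp add: power2_eq_square algebra_simps)
  have 3: "(z + 1)\<^sup>2 \<le> 2 * lyapunov s + 2"
  proof (cases q)
    case True
    then have "lyapunov s = 11 / 18 * (z + 1)\<^sup>2" by (simp add: s z_def)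
    moreover have "w \<le> 2 * (11 / 18 * w) + 2" if "0 \<le> w" for w :: real
      using that by simp
    ultimately show ?thesis by (metis zero_le_power2)
  next
    case False
    then have "lyapunov s = z\<^sup>2" by (simp add: s z_def)
    then show ?thesis
      using zero_le_power2[of "z - 1"] by (simp add: power2_eq_square algebra_simps)
  qed
  have 4: "0 \<le> lyapunov s" by (cases q) (auto simp: s)
  have "D2 \<le> 72 * (M2 + l + 1)"
    if "E2 \<le> 9 * Z2" "D2 \<le> 2 * M2 + 2 * E2" "Z2 \<le> 2 * l + 2" "0 \<le> l" "0 \<le> M2"
    for D2 E2 M2 Z2 l :: real
    using that by argo
  from this[OF 1[unfolded power_mult_distrib, simplified] 2 3 4 zero_le_power2]
  show ?thesis by (simp only: energy_def M_def D_def)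
qed

section \<open>Averages over all words of a given length\<close>

definition words :: "nat \<Rightarrow> nat list set"
  where "words n = {w. set w \<subseteq> {0, 1} \<and> length w = n}"

lemma finite_words [simp]: "finite (words n)"
  unfolding words_def by (rule finite_lists_length_eq) simp

lemma words_0: "words 0 = {[]}"
  by (auto simp: words_def)

lemma sum_words_Suc: "sum f (words (Suc n)) = (\<Sum>w\<in>words n. f (w @ [0]) + f (w @ [1 :: nat]))"
  for f :: "nat list \<Rightarrow> real"
proof -
  have "words (Suc n) = (\<lambda>w. w @ [0]) ` words n \<union> (\<lambda>w. w @ [1]) ` words n"
  proof (intro set_eqI iffI)
    fix w assume w: "w \<in> words (Suc n)"
    then obtain v d where "w = v @ [d]" by (cases w rule: rev_cases) (auto simp: words_def)
    with w show "w \<in> (\<lambda>w. w @ [0]) ` words n \<union> (\<lambda>w. w @ [1]) ` words n"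
      by (auto simp: words_def)
  qed (auto simp: words_def)
  then have "sum f (words (Suc n)) = sum f ((\<lambda>w. w @ [0]) ` words n) + sum f ((\<lambda>w. w @ [1]) ` words n)"
    by (auto intro!: sum.union_disjoint)
  then show ?thesis
    by (simp add: sum.reindex inj_on_def sum.distrib)
qed

lemma card_words: "real (card (words n)) = 2 ^ n"
proof (induction n)
  case (Suc n)
  then show ?case using sum_words_Suc[of "\<lambda>_. 1" n] by simp
qed (simp add: words_0)

text \<open>Divided by \<open>2 ^ n\<close> this is a mean over fair tosses: the start state has
  energy 0 and, by \<open>energy_step\<close>, each toss adds at most 1 on average.\<close>

lemma sum_energy: "(\<Sum>w\<in>words n. energy n (run w)) \<le> 2 ^ n * real n"
proof (induction n)
  case 0
  show ?case by (simp add: words_0 energy_def)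
next
  case (Suc n)
  have "(\<Sum>w\<in>words (Suc n). energy (Suc n) (run w)) \<le> (\<Sum>w\<in>words n. 2 * (energy n (run w) + 1))"
    unfolding sum_words_Suc using energy_step by (intro sum_mono) simp
  also have "\<dots> = 2 * ((\<Sum>w\<in>words n. energy n (run w)) + 2 ^ n)"
    by (simp add: sum_distrib_left[symmetric] sum.distrib card_words)
  also have "\<dots> \<le> 2 ^ Suc n * real (Suc n)" using Suc by (simp add: algebra_simps)
  finally show ?case .
qed

section \<open>Almost sure digit frequency\<close>

lemma emeasure_coin_cylinder:
  assumes "finite J" "J \<subseteq> {1..}" "f ` J \<subseteq> {0, 1}"
  shows "{a \<in> space coin_measure. \<forall>i\<in>J. a i = f i} \<in> sets coin_measure"
    and "measure coin_measure {a \<in> space coin_measure. \<forall>i\<in>J. a i = f i} = (1 / 2) ^ card J"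
proof -
  let ?U = "uniform_count_measure {0, 1 :: nat}"
  interpret prob_space coin_measure by (rule prob_space_coin_measure)
  have U: "prob_space ?U" by (rule prob_space_uniform_count_measure) auto
  have eq: "{a \<in> space coin_measure. \<forall>i\<in>J. a i = f i} = prod_emb {1..} (\<lambda>_. ?U) J (\<Pi>\<^sub>E i\<in>J. {f i})"
  proof (subst prod_emb_PiE)
    show "{a \<in> space coin_measure. \<forall>i\<in>J. a i = f i} =
        (\<Pi>\<^sub>E i\<in>{1..}. if i \<in> J then {f i} else space ?U)"
      using assms(2,3) unfolding space_coin_measure space_uniform_count_measure
      by (intro set_eqI) (unfold PiE_iff mem_Collect_eq, (auto split: if_splits; blast))
  qed (use assms(2,3) in \<open>auto simp: space_uniform_count_measure\<close>)
  show "{a \<in> space coin_measure. \<forall>i\<in>J. a i = f i} \<in> sets coin_measure"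
    unfolding eq unfolding coin_measure_def using assms
    by (intro sets_PiM_I) (auto simp: sets_uniform_count_measure)
  have "emeasure coin_measure {a \<in> space coin_measure. \<forall>i\<in>J. a i = f i} = (\<Prod>i\<in>J. emeasure ?U {f i})"
    unfolding eq unfolding coin_measure_def using assms U
    by (intro emeasure_PiM_emb) (auto simp: sets_uniform_count_measure)
  also have "\<dots> = (\<Prod>i\<in>J. ennreal (1 / 2))"
    using assms(3) by (intro prod.cong) (auto simp: emeasure_uniform_count_measure divide_ennreal)
  also have "\<dots> = ennreal ((1 / 2) ^ card J)"
    by (simp only: prod_constant) (rule ennreal_power, simp)
  finally show "measure coin_measure {a \<in> space coin_measure. \<forall>i\<in>J. a i = f i} = (1 / 2) ^ card J"
    by (simp add: measure_def)
qed

lemma measure_coin_prefix: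
  assumes "S \<subseteq> words n"
  shows "{a \<in> space coin_measure. prefix a n \<in> S} \<in> sets coin_measure"
    and "measure coin_measure {a \<in> space coin_measure. prefix a n \<in> S} = real (card S) / 2 ^ n"
proof -
  interpret prob_space coin_measure by (rule prob_space_coin_measure)
  define C where "C w = {a \<in> space coin_measure. prefix a n = w}" for w
  have C: "C w \<in> sets coin_measure" "measure coin_measure (C w) = (1 / 2) ^ n" if "w \<in> S" for w
  proof -
    have w: "length w = n" "set w \<subseteq> {0, 1}" using that assms by (auto simp: words_def)
    have "C w = {a \<in> space coin_measure. \<forall>i\<in>{1..n}. a i = w ! (i - 1)}"
    proof -
      have "prefix a n = w \<longleftrightarrow> (\<forall>i\<in>{1..n}. a i = w ! (i - 1))" for a
      proof -
        have "prefix a n = w \<longleftrightarrow> (\<forall>j<n. a (Suc j) = w ! j)"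
          using w by (simp add: list_eq_iff_nth_eq prefix_def del: upt_Suc)
        also have "\<dots> \<longleftrightarrow> (\<forall>i\<in>{1..n}. a i = w ! (i - 1))"
        proof safe
          fix i assume "\<forall>j<n. a (Suc j) = w ! j" "i \<in> {1..n}"
          then show "a i = w ! (i - 1)" by (cases i) auto
        next
          fix j assume "\<forall>i\<in>{1..n}. a i = w ! (i - 1)" "j < n"
          then show "a (Suc j) = w ! j" by (auto dest: bspec[of _ _ "Suc j"])
        qed
        finally show ?thesis .
      qed
      then show ?thesis by (simp add: C_def)
    qed
    moreover have "(\<lambda>i. w ! (i - 1)) ` {1..n} \<subseteq> {0, 1}"
      using w by (auto simp: subset_iff)
         (metis One_nat_def Suc_le_eq Suc_pred nth_mem)
    ultimately show "C w \<in> sets coin_measure" "measure coin_measure (C w) = (1 / 2) ^ n"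
      using emeasure_coin_cylinder[of "{1..n}" "\<lambda>i. w ! (i - 1)"] by auto
  qed
  have fin: "finite S" using assms finite_words by (rule finite_subset)
  have eq: "{a \<in> space coin_measure. prefix a n \<in> S} = (\<Union>w\<in>S. C w)"
    by (auto simp: C_def)
  show "{a \<in> space coin_measure. prefix a n \<in> S} \<in> sets coin_measure"
    unfolding eq using C(1) fin by auto
  have "measure coin_measure (\<Union>w\<in>S. C w) = (\<Sum>w\<in>S. measure coin_measure (C w))"
    using fin C(1) by (intro finite_measure_finite_Union) (auto simp: disjoint_family_on_def C_def)
  then show "measure coin_measure {a \<in> space coin_measure. prefix a n \<in> S} = real (card S) / 2 ^ n"
    unfolding eq using C(2) by (simp add: power_divide)
qed

lemma coin_digit: "a \<in> space coin_measure \<Longrightarrow> 1 \<le> i \<Longrightarrow> a i \<in> {0, 1}"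
  unfolding space_coin_measure by (rule PiE_mem) auto

lemma prefix_in_words:
  assumes "a \<in> space coin_measure"
  shows "prefix a n \<in> words n"
proof -
  have "a ` {1..<Suc n} \<subseteq> {0, 1}"
    by (intro image_subsetI coin_digit[OF assms]) auto
  then show ?thesis by (simp add: words_def prefix_def del: upt_Suc)
qed

text \<open>At time \<open>m^4\<close> the mean energy is at most \<open>m^4\<close>, so by Markov's
  inequality it exceeds \<open>m^6\<close> with probability at most \<open>1 / m^2\<close>, which is
  summable; yet \<open>m^6\<close> is small against the squared time \<open>m^8\<close>.\<close>

lemma AE_energy_bound:
  "AE a in coin_measure. \<forall>\<^sub>F m in sequentially. energy (m ^ 4) (run (prefix a (m ^ 4))) \<le> real m ^ 6"
proof -
  interpret prob_space coin_measure by (rule prob_space_coin_measure)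
  define S where "S m = {w \<in> words (m ^ 4). real m ^ 6 < energy (m ^ 4) (run w)}" for m
  define A where "A m = {a \<in> space coin_measure. prefix a (m ^ 4) \<in> S m}" for m
  have SW: "S m \<subseteq> words (m ^ 4)" for m by (auto simp: S_def)
  have A: "A m \<in> sets coin_measure" "measure coin_measure (A m) = real (card (S m)) / 2 ^ (m ^ 4)" for m
    using measure_coin_prefix[OF SW] by (auto simp: A_def)
  have bound: "measure coin_measure (A m) \<le> inverse (real m ^ 2)" if "m > 0" for m
  proof -
    have "real m ^ 6 * real (card (S m)) = (\<Sum>w\<in>S m. real m ^ 6)" by simp
    also have "\<dots> \<le> (\<Sum>w\<in>S m. energy (m ^ 4) (run w))"
      by (intro sum_mono) (auto simp: S_def)
    also have "\<dots> \<le> (\<Sum>w\<in>words (m ^ 4). energy (m ^ 4) (run w))"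
      using SW energy_nonneg by (intro sum_mono2) auto
    also have "\<dots> \<le> 2 ^ (m ^ 4) * real (m ^ 4)" by (rule sum_energy)
    finally have "real m ^ 4 * (real m ^ 2 * real (card (S m))) \<le> real m ^ 4 * 2 ^ (m ^ 4)"
      by (simp add: power_add[symmetric] mult_ac flip: mult.assoc)
    then have "real m ^ 2 * real (card (S m)) \<le> 2 ^ (m ^ 4)"
      by (rule mult_left_le_imp_le) (use that in simp)
    then show ?thesis using that unfolding A by (simp add: field_simps)
  qed
  have "summable (\<lambda>m. measure coin_measure (A m))"
  proof (rule summable_comparison_test')
    show "summable (\<lambda>m. inverse (real m ^ 2))" by (rule inverse_power_summable) simp
    show "norm (measure coin_measure (A m)) \<le> inverse (real m ^ 2)" if "m \<ge> 1" for m
      using bound[of m] that by simp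
  qed
  then have "AE a in coin_measure. \<forall>\<^sub>F m in sequentially. a \<in> space coin_measure - A m"
    using A(1) by (intro borel_cantelli_AE1) (auto simp: less_top[symmetric])
  then show ?thesis
  proof (rule AE_mp, intro AE_I2 impI)
    fix a assume a: "a \<in> space coin_measure"
      and "\<forall>\<^sub>F m in sequentially. a \<in> space coin_measure - A m"
    then show "\<forall>\<^sub>F m in sequentially. energy (m ^ 4) (run (prefix a (m ^ 4))) \<le> real m ^ 6"
      by (elim eventually_mono) (use prefix_in_words[OF a] in \<open>auto simp: A_def S_def not_less\<close>)
  qed
qed

text \<open>A prescribed run of \<open>j\<close> ones has probability \<open>(1 / 2) ^ j\<close>.
  The zeros serve to keep every tail value strictly below \<phi>.\<close>

lemma AE_infinitely_many_zeros: "AE a in coin_measure. \<forall>n. \<exists>j. a (Suc (n + j)) = 0"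
  unfolding AE_all_countable
proof
  fix n
  interpret prob_space coin_measure by (rule prob_space_coin_measure)
  define N where "N j = {a \<in> space coin_measure. \<forall>i\<in>{Suc n..n + j}. a i = 1}" for j
  have N: "N j \<in> sets coin_measure" "measure coin_measure (N j) = (1 / 2) ^ j" for j
    using emeasure_coin_cylinder[of "{Suc n..n + j}" "\<lambda>_. 1"] by (auto simp: N_def)
  have null: "(\<Inter>j. N j) \<in> null_sets coin_measure"
  proof -
    have "measure coin_measure (\<Inter>j. N j) \<le> (1 / 2) ^ j" for j
      using finite_measure_mono[of "\<Inter>j. N j" "N j"] N by auto
    moreover have "(\<lambda>j. (1 / 2 :: real) ^ j) \<longlonglongrightarrow> 0" by (rule LIMSEQ_power_zero) simp
    ultimately have "measure coin_measure (\<Inter>j. N j) \<le> 0"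
      by (intro LIMSEQ_le_const) auto
    then have "emeasure coin_measure (\<Inter>j. N j) = 0"
      by (simp add: emeasure_eq_measure measure_le_0_iff)
    then show ?thesis using N by auto
  qed
  show "AE a in coin_measure. \<exists>j. a (Suc (n + j)) = 0"
  proof (rule AE_I')
    show "(\<Inter>j. N j) \<in> null_sets coin_measure" by (rule null)
    show "{a \<in> space coin_measure. \<not> (\<exists>j. a (Suc (n + j)) = 0)} \<subseteq> (\<Inter>j. N j)"
    proof safe
      fix a j assume a: "a \<in> space coin_measure" "\<not> (\<exists>j. a (Suc (n + j)) = 0)"
      have "a i = 1" if "Suc n \<le> i" for i
      proof -
        have "a (Suc (n + (i - Suc n))) \<noteq> 0" using a(2) by auto
        then have "a i \<noteq> 0" using that by simp
        moreover have "a i \<in> {0, 1}" using coin_digit[OF a(1), of i] that by simp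
        ultimately show ?thesis by simp
      qed
      then show "a \<in> N j" using a by (simp add: N_def)
    qed
  qed
qed

text \<open>A monotone \<open>f\<close> is squeezed between its values at consecutive fourth powers,
  whose ratio tends to 1.\<close>

lemma tendsto_average_of_fourth_powers:
  fixes f :: "nat \<Rightarrow> real"
  assumes mono: "mono f" and f0: "0 \<le> f 0"
    and lim: "(\<lambda>m. f (m ^ 4) / real m ^ 4) \<longlonglongrightarrow> \<gamma>"
  shows "(\<lambda>n. f n / real n) \<longlonglongrightarrow> \<gamma>"
proof -
  define r where "r n = nat \<lfloor>root 4 (real n)\<rfloor>" for n :: nat
  have f_nonneg: "0 \<le> f n" for n using f0 monoD[OF mono, of 0 n] by simp
  have r: "r n ^ 4 \<le> n" "n < Suc (r n) ^ 4" for n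
  proof -
    have b: "real (r n) \<le> root 4 (real n)" "root 4 (real n) < real (Suc (r n))"
      unfolding r_def by (simp_all add: floor_le_iff) linarith
    have "real (r n) ^ 4 \<le> root 4 (real n) ^ 4" using b by (intro power_mono) auto
    then have "real (r n ^ 4) \<le> real n" by simp
    then show "r n ^ 4 \<le> n" by (simp only: of_nat_le_iff)
    have "root 4 (real n) ^ 4 < real (Suc (r n)) ^ 4"
      using b by (intro power_strict_mono) auto
    then have "real n < real (Suc (r n) ^ 4)" by simp
    then show "n < Suc (r n) ^ 4" by (simp only: of_nat_less_iff)
  qed
  have r_lim: "filterlim r sequentially sequentially"
    unfolding filterlim_at_top
  proof
    fix K
    show "\<forall>\<^sub>F n in sequentially. K \<le> r n"
    proof (rule eventually_sequentiallyI[of "K ^ 4"])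
      fix n assume "K ^ 4 \<le> n"
      with r(2)[of n] have "K ^ 4 < Suc (r n) ^ 4" by linarith
      then show "K \<le> r n" by (meson less_Suc_eq_le power_less_imp_less_base zero_le)
    qed
  qed
  have lower: "(\<lambda>m. (f (m ^ 4) / real m ^ 4) * (real m ^ 4 / real (Suc m) ^ 4)) \<longlonglongrightarrow> \<gamma> * 1"
    by (intro tendsto_mult lim) real_asymp
  have upper: "(\<lambda>m. (f (Suc m ^ 4) / real (Suc m) ^ 4) * (real (Suc m) ^ 4 / real m ^ 4)) \<longlonglongrightarrow> \<gamma> * 1"
    by (intro tendsto_mult lim[THEN LIMSEQ_Suc]) real_asymp
  \<comment> \<open>For \<open>r n = 0\<close> the quotients by \<open>real (r n) ^ 4\<close> are 0
    by convention, which would spoil the upper bound.\<close>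
  have pos: "\<forall>\<^sub>F n in sequentially. 0 < r n"
    using r_lim eventually_gt_at_top[of 0] by (rule eventually_compose_filterlim[rotated])
  show ?thesis
  proof (rule tendsto_sandwich)
    show "(\<lambda>n. (f (r n ^ 4) / real (r n) ^ 4) * (real (r n) ^ 4 / real (Suc (r n)) ^ 4)) \<longlonglongrightarrow> \<gamma>"
      using filterlim_compose[OF lower r_lim] by simp
    show "(\<lambda>n. (f (Suc (r n) ^ 4) / real (Suc (r n)) ^ 4) * (real (Suc (r n)) ^ 4 / real (r n) ^ 4)) \<longlonglongrightarrow> \<gamma>"
      using filterlim_compose[OF upper r_lim] by simp
    show "\<forall>\<^sub>F n in sequentially.
        (f (r n ^ 4) / real (r n) ^ 4) * (real (r n) ^ 4 / real (Suc (r n)) ^ 4) \<le> f n / real n"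
      using pos
    proof eventually_elim
      case (elim n)
      have n: "0 < n" using r(1)[of n] elim by (metis gr0I le_zero_eq power_eq_0_iff less_irrefl)
      have "f (r n ^ 4) / real (Suc (r n)) ^ 4 \<le> f n / real n"
        using n f_nonneg r[of n] monoD[OF mono r(1)]
        by (intro frac_le) (auto simp flip: of_nat_power simp del: of_nat_Suc power_Suc)
      then show ?case using elim by simp
    qed
    show "\<forall>\<^sub>F n in sequentially.
        f n / real n \<le> (f (Suc (r n) ^ 4) / real (Suc (r n)) ^ 4) * (real (Suc (r n)) ^ 4 / real (r n) ^ 4)"
      using pos
    proof eventually_elim
      case (elim n)
      have "f n / real n \<le> f (Suc (r n) ^ 4) / real (r n) ^ 4"
        using elim f_nonneg r[of n] monoD[OF mono less_imp_le[OF r(2)]]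
        by (intro frac_le) (auto simp flip: of_nat_power simp del: of_nat_Suc power_Suc)
      then show ?case by simp
    qed
  qed
qed

text \<open>At times \<open>m^4\<close> the squared error of the average is eventually at most
  \<open>72 * (m^6 + 1) / m^8\<close>; monotone counts fill in the other times.\<close>

lemma has_freq_of_energy:
  assumes norm: "\<And>n. normalises y (t n) n (s n)"
    and energy: "\<forall>\<^sub>F m in sequentially. energy (m ^ 4) (s (m ^ 4)) \<le> real m ^ 6"
  shows "has_freq (5 / 18) y"
  unfolding has_freq_def
proof (rule tendsto_average_of_fourth_powers)
  show "mono (\<lambda>n. real (ones n y))" by (simp add: mono_def ones_mono)
  let ?d = "\<lambda>m. real (ones (m ^ 4) y) / real m ^ 4 - 5 / 18"
  have "(\<lambda>m. (?d m)\<^sup>2) \<longlonglongrightarrow> 0"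
  proof (rule tendsto_sandwich[where f = "\<lambda>_. 0"])
    show "\<forall>\<^sub>F m in sequentially. (?d m)\<^sup>2 \<le> 72 * (real m ^ 6 + 1) / real m ^ 8"
      using energy eventually_gt_at_top[of 0]
    proof eventually_elim
      case (elim m)
      have "?d m = (real (ones (m ^ 4) y) - 5 / 18 * real (m ^ 4)) / real m ^ 4"
        using elim(2) by (simp add: diff_divide_distrib)
      then have "(?d m)\<^sup>2 = (real (ones (m ^ 4) y) - 5 / 18 * real (m ^ 4))\<^sup>2 / (real m ^ 4)\<^sup>2"
        by (simp only: power_divide)
      also have "(real m ^ 4)\<^sup>2 = real m ^ 8" by (simp flip: power_mult)
      finally have "(?d m)\<^sup>2 = (real (ones (m ^ 4) y) - 5 / 18 * real (m ^ 4))\<^sup>2 / real m ^ 8" .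
      also have "\<dots> \<le> 72 * (energy (m ^ 4) (s (m ^ 4)) + 1) / real m ^ 8"
        by (intro divide_right_mono ones_deviation[OF norm]) simp
      also have "\<dots> \<le> 72 * (real m ^ 6 + 1) / real m ^ 8"
        using elim(1) by (intro divide_right_mono) auto
      finally show ?case .
    qed
    show "(\<lambda>m. 72 * (real m ^ 6 + 1) / real m ^ 8) \<longlonglongrightarrow> 0" by real_asymp
  qed auto
  then have "?d \<longlonglongrightarrow> 0"
    using tendsto_real_sqrt[of "\<lambda>m. (?d m)\<^sup>2"] by (simp add: tendsto_rabs_zero_iff)
  then show "(\<lambda>m. real (ones (m ^ 4) y) / real m ^ 4) \<longlonglongrightarrow> 5 / 18"
    by (simp add: LIM_zero_iff)
qed simp

section \<open>Coin sequences and the points they represent\<close>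

definition remainder :: "(nat \<Rightarrow> nat) \<Rightarrow> nat \<Rightarrow> real"
  where "remainder a n = (\<Sum>i. real (a (Suc (i + n))) / \<phi> ^ Suc i)"

lemma beta_value_eq_remainder: "beta_value \<phi> a = remainder a 0"
  by (simp add: beta_value_def remainder_def)

lemma geometric_golden: "(\<lambda>i. 1 / \<phi> ^ Suc i) sums \<phi>"
proof -
  have "(\<lambda>i. (1 / \<phi>) * (1 / \<phi>) ^ i) sums ((1 / \<phi>) * (1 / (1 - 1 / \<phi>)))"
    by (intro sums_mult geometric_sums) simp
  moreover have "(1 / \<phi>) * (1 / (1 - 1 / \<phi>)) = 1 / (\<phi> - 1)"
    using golden_bounds by (simp add: field_simps)
  ultimately show ?thesis by (simp add: power_divide inverse_golden_minus_one)
qed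

lemma
  assumes a: "\<And>i. a (Suc i) \<in> {0, 1}"
  shows remainder_Suc: "remainder a n = (real (a (Suc n)) + remainder a (Suc n)) / \<phi>"
    and remainder_nonneg: "0 \<le> remainder a n"
    and remainder_le: "remainder a n \<le> \<phi>"
proof -
  have le: "real (a (Suc i)) \<le> 1" for i using a[of i] by auto
  have summ: "summable (\<lambda>i. real (a (Suc (i + n))) / \<phi> ^ Suc i)" for n
  proof (rule summable_comparison_test')
    show "summable (\<lambda>i. 1 / \<phi> ^ Suc i)" using geometric_golden by (rule sums_summable)
    show "norm (real (a (Suc (i + n))) / \<phi> ^ Suc i) \<le> 1 / \<phi> ^ Suc i" for i
      using le by (auto simp: divide_right_mono)
  qed
  show "0 \<le> remainder a n" unfolding remainder_def using summ by (intro suminf_nonneg) auto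
  have "remainder a n \<le> (\<Sum>i. 1 / \<phi> ^ Suc i)"
    unfolding remainder_def using summ geometric_golden le
    by (intro suminf_le divide_right_mono) (auto simp: sums_summable)
  then show "remainder a n \<le> \<phi>" using geometric_golden by (simp add: sums_iff)
  have "remainder a n = real (a (Suc n)) / \<phi> + (\<Sum>i. real (a (Suc (Suc i + n))) / \<phi> ^ Suc (Suc i))"
    unfolding remainder_def using suminf_split_head[OF summ[of n]] by simp
  also have "(\<Sum>i. real (a (Suc (Suc i + n))) / \<phi> ^ Suc (Suc i)) = remainder a (Suc n) / \<phi>"
    unfolding remainder_def by (subst suminf_divide[OF summ, symmetric]) (simp add: mult.commute)
  finally show "remainder a n = (real (a (Suc n)) + remainder a (Suc n)) / \<phi>"
    by (simp add: add_divide_distrib)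
qed

text \<open>A tail that starts with 0 has value at most 1, and prefixing a digit keeps the
  inequality strict, since \<open>r < \<phi>\<close> gives
  \<open>(1 + r) / \<phi> < (1 + \<phi>) / \<phi> = \<phi>\<close>.\<close>

lemma remainder_less:
  assumes a: "\<And>i. a (Suc i) \<in> {0, 1}" and zero: "a (Suc (n + j)) = 0"
  shows "remainder a n < \<phi>"
  using zero
proof (induction j arbitrary: n)
  case 0
  then have "remainder a n = remainder a (Suc n) / \<phi>" using remainder_Suc[of a n, OF a] by simp
  also have "\<dots> \<le> 1" using remainder_le[of a "Suc n", OF a] by simp
  finally show ?case using golden_bounds by simp
next
  case (Suc j)
  then have "remainder a (Suc n) < \<phi>" by simp
  moreover have "real (a (Suc n)) \<le> 1" using a[of n] by auto
  ultimately have "real (a (Suc n)) + remainder a (Suc n) < \<phi> * \<phi>"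
    unfolding golden_square by linarith
  then show ?case using remainder_Suc[of a n, OF a] by (simp add: divide_less_eq)
qed


lemma digit_freq_of_coins:
  assumes a: "a \<in> space coin_measure" and zeros: "\<forall>n. \<exists>j. a (Suc (n + j)) = 0"
    and energy: "\<forall>\<^sub>F m in sequentially. energy (m ^ 4) (run (prefix a (m ^ 4))) \<le> real m ^ 6"
  shows "beta_value \<phi> a \<in> digit_freq_set \<phi> (5 / 18)"
proof -
  have dig: "a (Suc i) \<in> {0, 1}" for i using coin_digit[OF a] by simp
  define x where "x = remainder a 0"
  have less: "remainder a n < \<phi>" for n using remainder_less[of a, OF dig] zeros by blast
  have x: "0 \<le> x" "x < \<phi>" using less[of 0] remainder_nonneg[of a 0, OF dig] by (auto simp: x_def)
  have "normalises (x / \<phi>) (remainder a n) n (run (prefix a n))" for n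
    unfolding x_def
    by (rule normalises_run) (fact dig less remainder_nonneg[of a, OF dig] remainder_Suc[of a, OF dig])+
  then have "has_freq (5 / 18) (x / \<phi>)" using energy by (rule has_freq_of_energy)
  then have freq: "has_freq (5 / 18) (T (x / \<phi>))" by (simp add: has_freq_T)
  \<comment> \<open>The automaton treats \<open>x / \<phi>\<close>. If \<open>x < 1\<close>, its
    first greedy digit is the extra 0 and \<open>T\<close> returns \<open>x\<close>; otherwise that
    digit is 1 and \<open>T\<close> returns \<open>x - 1\<close>, whose orbit merges with that of
    \<open>x\<close>.\<close>
  have "has_freq (5 / 18) x"
  proof (cases "x < 1")
    case True
    then have "x / \<phi> < \<phi> - 1" unfolding inverse_golden[symmetric] by (simp add: divide_strict_right_mono)
    then show ?thesis using freq by (simp add: T_low)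
  next
    case False
    then have "\<phi> - 1 \<le> x / \<phi>" unfolding inverse_golden[symmetric] by (simp add: divide_right_mono)
    then show ?thesis using freq has_freq_minus_one[of x] x False by (simp add: T_high)
  qed
  then show ?thesis using x by (simp add: digit_freq_set_golden beta_value_eq_remainder x_def)
qed

lemma AE_digit_freq: "AE a in coin_measure. beta_value \<phi> a \<in> digit_freq_set \<phi> (5 / 18)"
  using AE_space AE_energy_bound AE_infinitely_many_zeros
  by eventually_elim (rule digit_freq_of_coins)

lemma sets_digit_freq: "digit_freq_set \<phi> \<gamma> \<in> sets borel"
proof -
  have T [measurable]: "T \<in> borel_measurable borel"
    unfolding greedy_map_def by measurable
  have [measurable]: "(T ^^ n) \<in> borel_measurable borel" for n
    by (induction n) (simp_all add: id_def comp_def)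
  have "(\<lambda>x. real (greedy_digit \<phi> x k)) \<in> borel_measurable borel" for k
    unfolding greedy_digit_def by measurable
  then show ?thesis
    unfolding digit_freq_set_def I_beta_def by measurable
qed

lemma emeasure_digit_freq: "emeasure (bernoulli_convolution \<phi>) (digit_freq_set \<phi> (5 / 18)) = 1"
proof -
  interpret prob_space "bernoulli_convolution \<phi>" by (rule prob_space_bernoulli_convolution)
  have "AE x in bernoulli_convolution \<phi>. x \<in> digit_freq_set \<phi> (5 / 18)"
    unfolding bernoulli_convolution_def
    by (subst AE_distr_iff) (use AE_digit_freq sets_digit_freq in auto)
  then show ?thesis using sets_digit_freq by (intro emeasure_eq_1_AE) auto
qed

section \<open>Hausdorff null sets\<close>

text \<open>The family is listed along \<open>to_nat\<close> with empty sets in the gaps, which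
  \<open>diam_pow\<close> counts as 0; bounds on finite subsums then suffice.\<close>

lemma hausdorff_premeasure_le_countable:
  fixes I :: "'i::countable \<Rightarrow> 'a::metric_space set"
  assumes cover: "A \<subseteq> (\<Union>j\<in>J. I j)"
    and fine: "\<And>j. j \<in> J \<Longrightarrow> bounded (I j) \<and> diameter (I j) \<le> \<delta>" and "0 \<le> \<delta>"
    and bound: "\<And>F. finite F \<Longrightarrow> F \<subseteq> J \<Longrightarrow> (\<Sum>j\<in>F. diam_pow s (I j)) \<le> B"
  shows "hausdorff_premeasure \<delta> s A \<le> B"
proof -
  define U where "U m = (if m \<in> to_nat ` J then I (from_nat m) else {})" for m
  have "A \<subseteq> (\<Union>m. U m)"
  proof
    fix x assume "x \<in> A"
    then obtain j where j: "j \<in> J" "x \<in> I j" using cover by blast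
    then have "x \<in> U (to_nat j)" by (simp add: U_def)
    then show "x \<in> (\<Union>m. U m)" by blast
  qed
  moreover have "bounded (U m) \<and> diameter (U m) \<le> \<delta>" for m
    using fine \<open>0 \<le> \<delta>\<close> by (auto simp: U_def)
  ultimately have "U \<in> fine_covers \<delta> A" by (simp add: fine_covers_def)
  then have "hausdorff_premeasure \<delta> s A \<le> (\<Sum>m. diam_pow s (U m))"
    unfolding hausdorff_premeasure_def by (rule INF_lower)
  also have "\<dots> \<le> B"
  proof (rule suminf_le_const[OF summableI])
    fix M
    define F where "F = {j \<in> J. to_nat j < M}"
    have inj: "inj_on to_nat F" by (rule inj_on_subset[OF inj_to_nat]) simp
    have "finite (to_nat ` F)" by (rule finite_subset[of _ "{..<M}"]) (auto simp: F_def)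
    then have fin: "finite F" using inj by (rule finite_imageD)
    have "(\<Sum>m<M. diam_pow s (U m)) = (\<Sum>m\<in>to_nat ` F. diam_pow s (U m))"
      by (rule sum.mono_neutral_right) (auto simp: F_def U_def diam_pow_def)
    also have "\<dots> = (\<Sum>j\<in>F. diam_pow s (I j))"
      by (subst sum.reindex[OF inj]) (auto simp: U_def F_def intro!: sum.cong)
    also have "\<dots> \<le> B" by (rule bound[OF fin]) (auto simp: F_def)
    finally show "(\<Sum>m<M. diam_pow s (U m)) \<le> B" .
  qed
  finally show ?thesis .
qed

text \<open>A diameter \<open>d \<le> 1\<close> satisfies \<open>d \<le> d powr s\<close>, and a set
  of diameter \<open>d\<close> lies in an interval of length \<open>2 * d\<close>; so Lebesgue
  measure is at most twice the covering sum.\<close>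

lemma hausdorff_null_imp_lborel_null:
  fixes A :: "real set"
  assumes null: "hausdorff_measure s A = 0" and s: "0 \<le> s" "s \<le> 1" and A: "A \<in> sets borel"
  shows "emeasure lborel A = 0"
proof -
  have "hausdorff_premeasure 1 s A \<le> hausdorff_measure s A"
    unfolding hausdorff_measure_def by (rule SUP_upper) simp
  then have "hausdorff_premeasure 1 s A = 0" using null by simp
  have "emeasure lborel A \<le> 0 + ennreal e" if "0 < e" for e
  proof -
    have "hausdorff_premeasure 1 s A < ennreal (e / 2)"
      using \<open>hausdorff_premeasure 1 s A = 0\<close> that by simp
    then obtain U where U: "U \<in> fine_covers 1 A" and sum: "(\<Sum>n. diam_pow s (U n)) < ennreal (e / 2)"
      unfolding hausdorff_premeasure_def INF_less_iff by blast
    define p where "p n = (SOME x. x \<in> U n)" for n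
    define V where "V n = (if U n = {} then {} else {p n - diameter (U n)..p n + diameter (U n)})" for n
    have bd: "bounded (U n)" "0 \<le> diameter (U n)" "diameter (U n) \<le> 1" for n
      using U by (auto simp: fine_covers_def diameter_ge_0)
    have "U n \<subseteq> V n" for n
    proof
      fix x assume x: "x \<in> U n"
      then have "p n \<in> U n" unfolding p_def by (rule someI)
      then have "dist x (p n) \<le> diameter (U n)" using diameter_bounded_bound[OF bd(1)] x by blast
      then show "x \<in> V n" using x by (auto simp: V_def dist_real_def)
    qed
    then have "A \<subseteq> (\<Union>n. V n)" using U by (fastforce simp: fine_covers_def)
    then have "emeasure lborel A \<le> emeasure lborel (\<Union>n. V n)"
      by (intro emeasure_mono) (auto simp: V_def)
    also have "\<dots> \<le> (\<Sum>n. emeasure lborel (V n))"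
      by (rule emeasure_subadditive_countably) (auto simp: V_def)
    also have "\<dots> \<le> (\<Sum>n. 2 * diam_pow s (U n))"
    proof (rule suminf_le)
      fix n
      let ?d = "diameter (U n)"
      show "emeasure lborel (V n) \<le> 2 * diam_pow s (U n)"
      proof (cases "U n = {}")
        case False
        have "ennreal ?d \<le> diam_pow s (U n)"
        proof (cases "s = 0")
          case True
          then show ?thesis using False bd(3)[of n] by (simp add: diam_pow_def)
        next
          case s0: False
          have "?d \<le> ?d powr s"
            using powr_mono'[of s 1 ?d] bd[of n] s by (cases "?d = 0") auto
          then show ?thesis using False s0 by (simp add: diam_pow_def ennreal_leI)
        qed
        then have "2 * ennreal ?d \<le> 2 * diam_pow s (U n)" by (rule mult_left_mono) simp
        moreover have "emeasure lborel (V n) = 2 * ennreal ?d"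
          using False bd(2)[of n] by (simp add: V_def ennreal_mult[symmetric, of 2] flip: ennreal_numeral)
        ultimately show ?thesis by simp
      qed (simp add: V_def)
    qed auto
    also have "\<dots> = 2 * (\<Sum>n. diam_pow s (U n))" by simp
    also have "\<dots> \<le> 2 * ennreal (e / 2)" using sum by (intro mult_left_mono) auto
    also have "\<dots> = ennreal e"
      using that by (simp add: ennreal_mult[symmetric] flip: ennreal_numeral)
    finally show ?thesis by simp
  qed
  then have "emeasure lborel A \<le> 0" by (rule ennreal_le_epsilon) 
  then show ?thesis by simp
qed

section \<open>Greedy words\<close>

text \<open>The words without two adjacent ones, split by their initial block 0 or 10 so that
  weighted counts obey a two-term recursion.\<close>

fun greedy_words :: "nat \<Rightarrow> nat list set" where
  "greedy_words 0 = {[]}"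
| "greedy_words (Suc 0) = {[0], [1]}"
| "greedy_words (Suc (Suc n)) = (#) 0 ` greedy_words (Suc n) \<union> (\<lambda>v. 1 # 0 # v) ` greedy_words n"

lemma finite_greedy_words [simp]: "finite (greedy_words n)"
  by (induction n rule: greedy_words.induct) auto

lemma length_greedy_words: "v \<in> greedy_words n \<Longrightarrow> length v = n"
  by (induction n arbitrary: v rule: greedy_words.induct) auto

lemma greedy_word_exists:
  "0 \<le> x \<Longrightarrow> x < 1 \<Longrightarrow> \<exists>v\<in>greedy_words n. \<exists>t. 0 \<le> t \<and> t < 1 \<and> x = word_val v t \<and> sum_list v = ones n x"
proof (induction n arbitrary: x rule: greedy_words.induct)
  case 1
  then show ?case by auto
next
  case 2
  show ?case
  proof (cases "x < \<phi> - 1")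
    case True
    then have "\<phi> * x < 1" unfolding inverse_golden[symmetric] by (simp add: field_simps)
    then show ?thesis using True 2
      by (intro bexI[of _ "[0]"] exI[of _ "\<phi> * x"]) (auto simp: ones_Suc)
  next
    case False
    have "\<phi> * x < 2" using 2 golden_bounds mult_strict_left_mono[of x 1 \<phi>] by linarith
    moreover have "1 \<le> \<phi> * x"
      using False unfolding inverse_golden[symmetric] by (simp add: field_simps not_less)
    ultimately show ?thesis using False
      by (intro bexI[of _ "[1]"] exI[of _ "\<phi> * x - 1"]) (auto simp: ones_Suc)
  qed
next
  case (3 n)
  show ?case
  proof (cases "x < \<phi> - 1")
    case True
    then have "\<phi> * x < 1" unfolding inverse_golden[symmetric] by (simp add: field_simps)
    moreover have "0 \<le> \<phi> * x" using 3 by simp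
    ultimately obtain v t where v: "v \<in> greedy_words (Suc n)" "0 \<le> t" "t < 1" "\<phi> * x = word_val v t"
      "sum_list v = ones (Suc n) (\<phi> * x)"
      using "3.IH"(1)[of "\<phi> * x"] by blast
    have "x = word_val (0 # v) t" by (simp flip: v(4))
    moreover have "sum_list (0 # v) = ones (Suc (Suc n)) x"
      using True v(5) by (simp add: ones_Suc[of "Suc n"] T_low)
    ultimately show ?thesis using v by (intro bexI[of _ "0 # v"]) auto
  next
    case False
    \<comment> \<open>A greedy digit 1 leaves \<open>y = T x\<close> below
      \<open>1 / \<phi>\<close>, so a 0 follows and both digits are stripped at once.\<close>
    define y where "y = \<phi> * x - 1"
    have "\<phi> * x < \<phi>" using 3 mult_strict_left_mono[of x 1 \<phi>] by simp
    moreover have "1 \<le> \<phi> * x"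
      using False unfolding inverse_golden[symmetric] by (simp add: field_simps not_less)
    ultimately have y: "0 \<le> y" "y < \<phi> - 1" by (auto simp: y_def)
    then have "\<phi> * y < 1" unfolding inverse_golden[symmetric] by (simp add: field_simps)
    moreover have "0 \<le> \<phi> * y" using y by simp
    ultimately obtain v t where v: "v \<in> greedy_words n" "0 \<le> t" "t < 1" "\<phi> * y = word_val v t"
      "sum_list v = ones n (\<phi> * y)"
      using "3.IH"(2)[of "\<phi> * y"] by blast
    have "x = word_val (1 # 0 # v) t" by (simp flip: v(4)) (simp add: y_def)
    moreover have "sum_list (1 # 0 # v) = ones (Suc (Suc n)) x"
      using False v(5) y by (simp add: ones_Suc T_high T_low y_def)
    ultimately show ?thesis using v by (intro bexI[of _ "1 # 0 # v"]) auto
  qed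
qed

lemma word_val_shift: "word_val v t = word_val v 0 + t / \<phi> ^ length v"
  by (induction v) (auto simp: add_divide_distrib mult.commute)

text \<open>The choice of \<tau> makes \<open>l\<close> a root of \<open>l^2 = l + \<tau>\<close>,
  the characteristic equation of the recursion of \<open>greedy_words\<close> with weight \<tau> per
  digit 1.\<close>

lemma sum_greedy_words:
  fixes l \<tau> :: real
  assumes "1 \<le> l" "\<tau> = l\<^sup>2 - l"
  shows "(\<Sum>v\<in>greedy_words n. \<tau> ^ sum_list v) \<le> l ^ Suc n"
proof (induction n rule: greedy_words.induct)
  case 1
  then show ?case using assms by simp
next
  case 2
  then show ?case using assms by (simp add: power2_eq_square)
next
  case (3 n)
  have nonneg: "0 \<le> \<tau>" using assms by (simp add: power2_eq_square)
  have "(\<Sum>v\<in>greedy_words (Suc (Suc n)). \<tau> ^ sum_list v) =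
      (\<Sum>v\<in>(#) 0 ` greedy_words (Suc n). \<tau> ^ sum_list v) +
      (\<Sum>v\<in>(\<lambda>v. 1 # 0 # v) ` greedy_words n. \<tau> ^ sum_list v)"
    unfolding greedy_words.simps by (rule sum.union_disjoint) auto
  also have "\<dots> = (\<Sum>v\<in>greedy_words (Suc n). \<tau> ^ sum_list v) + \<tau> * (\<Sum>v\<in>greedy_words n. \<tau> ^ sum_list v)"
    by (simp add: sum.reindex inj_on_def sum_distrib_left)
  also have "\<dots> \<le> l ^ Suc (Suc n) + \<tau> * l ^ Suc n"
    using 3 nonneg by (intro add_mono mult_left_mono)
  also have "\<dots> = l ^ Suc (Suc (Suc n))" by (simp add: assms(2) power2_eq_square algebra_simps)
  finally show ?case .
qed

text \<open>Markov's inequality for the weight \<open>\<tau> ^ sum_list v\<close>.\<close>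
lemma card_frequent_words:
  fixes l \<tau> \<kappa> :: real
  assumes "1 < l" "\<tau> = l\<^sup>2 - l" "1 < \<tau>"
  shows "real (card {v \<in> greedy_words n. \<kappa> * real n \<le> real (sum_list v)}) \<le> l * (l * \<tau> powr - \<kappa>) ^ n"
proof -
  let ?W = "{v \<in> greedy_words n. \<kappa> * real n \<le> real (sum_list v)}"
  define c where "c = \<tau> powr \<kappa>"
  have c: "0 < c" "\<tau> powr - \<kappa> = 1 / c" using assms by (simp_all add: c_def powr_minus_divide)
  have "c ^ n * real (card ?W) = (\<Sum>v\<in>?W. c ^ n)" by simp
  also have "\<dots> \<le> (\<Sum>v\<in>?W. \<tau> ^ sum_list v)"
  proof (rule sum_mono)
    fix v assume "v \<in> ?W"
    then have "\<tau> powr (\<kappa> * real n) \<le> \<tau> powr real (sum_list v)"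
      using assms by (intro powr_mono) auto
    also have "\<dots> = \<tau> ^ sum_list v" using assms by (intro powr_realpow) auto
    also have "\<tau> powr (\<kappa> * real n) = c ^ n"
      unfolding c_def using assms by (subst powr_power) (auto simp: mult.commute)
    finally show "c ^ n \<le> \<tau> ^ sum_list v" .
  qed
  also have "\<dots> \<le> (\<Sum>v\<in>greedy_words n. \<tau> ^ sum_list v)"
    using assms by (intro sum_mono2) auto
  also have "\<dots> \<le> l ^ Suc n" using assms by (intro sum_greedy_words) auto
  finally show ?thesis using c(1) unfolding c(2) by (simp add: field_simps power_divide)
qed

section \<open>Dimension of the frequency set\<close>

text \<open>\<open>1 / (\<phi> \<surd>5) < 5 / 18\<close>: the frequency exceeds that of the measure of maximal entropy.\<close>
lemma frequency_gap: "\<phi> - 1 < 5 / 18 * (2 * \<phi> - 1)"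
proof -
  have "sqrt 5 < 2.25" by (rule real_less_lsqrt) (simp_all add: power2_eq_square)
  then have "8 * \<phi> < 13" by (simp add: golden_def)
  then show ?thesis by argo
qed

text \<open>\<open>f\<close> is the logarithm of the Chernoff rate at threshold 5/18. At
  \<open>l = \<phi>\<close> one has \<tau> = 1 and rate \<phi>; by \<open>frequency_gap\<close> the
  derivative there is negative, so a slightly larger \<open>l\<close> gives a rate below
  \<phi>.\<close>

lemma entropy_gap:
  obtains l \<tau> \<kappa> :: real where "1 < l" "\<tau> = l\<^sup>2 - l" "1 < \<tau>" "\<kappa> < 5 / 18" "l * \<tau> powr - \<kappa> < \<phi>"
proof -
  define f where "f x = ln x - 5 / 18 * ln (x\<^sup>2 - x)" for x :: real
  have sq: "\<phi>\<^sup>2 - \<phi> = 1" using golden_square by (simp add: power2_eq_square)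
  have "DERIV f \<phi> :> 1 / \<phi> - 5 / 18 * (2 * \<phi> - 1)"
    unfolding f_def by (rule derivative_eq_intros refl | simp add: sq)+
  moreover have "1 / \<phi> - 5 / 18 * (2 * \<phi> - 1) < 0"
    using frequency_gap by (simp add: inverse_golden)
  ultimately obtain d where d: "0 < d" "\<forall>h>0. h < d \<longrightarrow> f (\<phi> + h) < f \<phi>"
    using DERIV_neg_dec_right by blast
  define l where "l = \<phi> + d / 2"
  define \<tau> where "\<tau> = l\<^sup>2 - l"
  have l: "\<phi> < l" "f l < f \<phi>" using d by (auto simp: l_def)
  have l1: "1 < l" using l(1) golden_bounds by simp
  have "\<phi> * (\<phi> - 1) < l * (l - 1)"
    using l(1) golden_bounds by (intro mult_strict_mono) auto
  then have \<tau>: "1 < \<tau>" using golden_square by (simp add: \<tau>_def power2_eq_square algebra_simps)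
  define D where "D = ln \<phi> - f l"
  have D: "0 < D" using l(2) sq by (simp add: D_def f_def)
  \<comment> \<open>Lowering the threshold from 5/18 by this amount spends half of the gain
    \<open>D\<close>.\<close>
  define \<kappa> where "\<kappa> = 5 / 18 - D / (2 * ln \<tau>)"
  have "\<kappa> < 5 / 18" using D \<tau> by (simp add: \<kappa>_def)
  moreover have "l * \<tau> powr - \<kappa> < \<phi>"
  proof -
    have "ln l - \<kappa> * ln \<tau> = ln \<phi> - D / 2"
      using \<tau> by (simp add: \<kappa>_def D_def f_def flip: \<tau>_def) (simp add: field_simps)
    then have "ln l - \<kappa> * ln \<tau> < ln \<phi>" using D by simp
    then have "exp (ln l - \<kappa> * ln \<tau>) < exp (ln \<phi>)" by (simp only: exp_less_cancel_iff)
    moreover have "exp (ln l - \<kappa> * ln \<tau>) = l * \<tau> powr - \<kappa>"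
      using \<tau> l1 by (simp add: powr_def exp_diff exp_minus divide_inverse)
    ultimately show ?thesis by simp
  qed
  ultimately show ?thesis using that l1 \<tau> \<tau>_def by blast
qed

lemma exponent_exists:
  assumes "0 < q" "q < \<phi>"
  obtains s where "0 < s" "s < 1" "q < \<phi> powr s"
proof
  define u where "u = ln q / ln \<phi>"
  have u: "u < 1" using assms by (simp add: u_def)
  \<comment> \<open>The midpoint of \<open>u\<close> and 1 lies above \<open>u\<close>; the maximum
    with 1/2 keeps \<open>s\<close> positive when \<open>u\<close> is very negative.\<close>
  define s where "s = max (1 / 2) ((1 + u) / 2)"
  show "0 < s" "s < 1" using u by (auto simp: s_def)
  have "u < s" using u by (simp add: s_def less_max_iff_disj)
  then have "ln q < s * ln \<phi>" by (simp add: u_def divide_less_eq)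
  then have "exp (ln q) < exp (s * ln \<phi>)" by (simp only: exp_less_cancel_iff)
  then show "q < \<phi> powr s" using assms by (simp add: powr_def)
qed

text \<open>The translation by \<open>b = 1\<close> accounts for the points above \<open>1\<close>.\<close>
definition cylinder :: "nat \<times> nat list \<Rightarrow> real set" where
  "cylinder = (\<lambda>(b, v). {real b + word_val v 0..real b + word_val v 0 + 1 / \<phi> ^ length v})"

lemma digit_freq_set_in_cylinders:
  assumes "\<kappa> < \<gamma>" "\<gamma> \<noteq> 1" "x \<in> digit_freq_set \<phi> \<gamma>"
  shows "\<exists>b\<in>{0, 1}. \<exists>n\<ge>N. \<exists>v\<in>greedy_words n. \<kappa> * real n \<le> real (sum_list v) \<and> x \<in> cylinder (b, v)"
proof -
  have x: "0 \<le> x" "x \<le> \<phi>" "has_freq \<gamma> x" using assms(3) by (auto simp: digit_freq_set_golden)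
  have "x \<noteq> \<phi>"
    using has_freq_golden x(3) assms(2) LIMSEQ_unique unfolding has_freq_def by blast
  then obtain b :: nat where b: "b \<in> {0, 1}" "0 \<le> x - real b" "x - real b < 1" "has_freq \<gamma> (x - real b)"
  proof (cases "x < 1")
    case True
    then show ?thesis using that[of 0] x by simp
  next
    case False
    then show ?thesis using that[of 1] x \<open>x \<noteq> \<phi>\<close> has_freq_minus_one[of x \<gamma>] golden_bounds by simp
  qed
  let ?y = "x - real b"
  have "\<forall>\<^sub>F n in sequentially. \<kappa> < real (ones n ?y) / real n"
    using b(4) assms(1) unfolding has_freq_def by (rule order_tendstoD)
  \<comment> \<open>At \<open>n = 0\<close> the quotient is 0 by convention and cannot be multiplied
    out, hence the maximum with 1.\<close>
  then have "\<forall>\<^sub>F n in sequentially. \<kappa> < real (ones n ?y) / real n \<and> max N 1 \<le> n"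
    using eventually_ge_at_top by (rule eventually_conj)
  then obtain n where n: "\<kappa> < real (ones n ?y) / real n" "N \<le> n" "0 < n"
    by (auto simp: eventually_sequentially)
  obtain v t where v: "v \<in> greedy_words n" "0 \<le> t" "t < 1" "?y = word_val v t" "sum_list v = ones n ?y"
    using greedy_word_exists[OF b(2,3)] by blast
  have "0 \<le> t / \<phi> ^ length v" "t / \<phi> ^ length v \<le> 1 / \<phi> ^ length v"
    using v(2,3) by (auto intro!: divide_right_mono)
  moreover have "x = real b + word_val v 0 + t / \<phi> ^ length v"
    using v(4) word_val_shift[of v t] by simp
  ultimately have "x \<in> cylinder (b, v)" by (simp add: cylinder_def)
  moreover have "\<kappa> * real n \<le> real (sum_list v)"
    using n v(5) by (simp add: less_divide_eq)
  ultimately show ?thesis using b(1) n(2) v(1) by blast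
qed

text \<open>At most \<open>l * q ^ n\<close> words of length \<open>n\<close> occur, each with two
  cylinders of diameter \<open>1 / \<phi> ^ n\<close>. As \<open>q < \<phi> powr s\<close>, the
  covering sum over \<open>n \<ge> N\<close> is bounded by a geometric tail with ratio
  \<rho>.\<close>

lemma hausdorff_measure_digit_freq_set:
  obtains s where "0 < s" "s < 1" "hausdorff_measure s (digit_freq_set \<phi> (5 / 18)) = 0"
proof -
  obtain l \<tau> \<kappa> :: real where par: "1 < l" "\<tau> = l\<^sup>2 - l" "1 < \<tau>" "\<kappa> < 5 / 18" "l * \<tau> powr - \<kappa> < \<phi>"
    by (rule entropy_gap)
  define q where "q = l * \<tau> powr - \<kappa>"
  have q: "0 < q" "q < \<phi>" using par by (auto simp: q_def)
  then obtain s where s: "0 < s" "s < 1" "q < \<phi> powr s" by (rule exponent_exists)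
  define \<rho> where "\<rho> = q / \<phi> powr s"
  have \<rho>: "0 < \<rho>" "\<rho> < 1" using q s by (auto simp: \<rho>_def divide_less_eq)
  let ?A = "digit_freq_set \<phi> (5 / 18)"
  define W where "W n = {v \<in> greedy_words n. \<kappa> * real n \<le> real (sum_list v)}" for n
  define J where "J N = (\<Union>n\<in>{N..}. {0, 1 :: nat} \<times> W n)" for N
  have diam: "diameter (cylinder (b, v)) = 1 / \<phi> ^ n" "bounded (cylinder (b, v))"
    "diam_pow s (cylinder (b, v)) = ennreal ((1 / \<phi> powr s) ^ n)" if "v \<in> W n" for b v n
  proof -
    have len: "length v = n" using that length_greedy_words by (auto simp: W_def)
    show *: "diameter (cylinder (b, v)) = 1 / \<phi> ^ n" "bounded (cylinder (b, v))"
      using golden_bounds by (auto simp: cylinder_def len)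
    have "(1 / \<phi> ^ n) powr s = (1 / \<phi> powr s) ^ n"
    proof -
      have "(\<phi> ^ n) powr s = (\<phi> powr s) ^ n"
        unfolding powr_realpow[OF golden_pos(1), symmetric] powr_powr powr_power[OF golden_pos(3)] ..
      then show ?thesis by (simp add: powr_divide power_divide)
    qed
    then show "diam_pow s (cylinder (b, v)) = ennreal ((1 / \<phi> powr s) ^ n)"
      using s(1) unfolding diam_pow_def * by (auto simp: cylinder_def)
  qed
  have pre: "hausdorff_premeasure \<delta> s ?A \<le> ennreal (2 * l * (\<rho> ^ N / (1 - \<rho>)))"
    if N: "1 / \<phi> ^ N \<le> \<delta>" for \<delta> N
  proof (rule hausdorff_premeasure_le_countable[where I = cylinder and J = "J N"])
    show "?A \<subseteq> (\<Union>j\<in>J N. cylinder j)"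
    proof
      fix x assume "x \<in> ?A"
      from digit_freq_set_in_cylinders[OF par(4) _ this, of N]
      show "x \<in> (\<Union>j\<in>J N. cylinder j)" by (fastforce simp: J_def W_def)
    qed
    show "bounded (cylinder j) \<and> diameter (cylinder j) \<le> \<delta>" if jJ: "j \<in> J N" for j
    proof -
      obtain b v n where j: "j = (b, v)" "v \<in> W n" "N \<le> n" using jJ by (auto simp: J_def)
      have "1 / \<phi> ^ n \<le> 1 / \<phi> ^ N" using j(3) by (intro divide_left_mono power_increasing) auto
      then show ?thesis using diam[OF j(2)] N j(1) by auto
    qed
    show "0 \<le> \<delta>" by (rule order_trans[OF _ N]) simp
    fix F assume F: "finite F" "F \<subseteq> J N"
    \<comment> \<open>A finite part of the cover involves only word lengths up to some
      \<open>K\<close>, so it lies in a finite union over \<open>n\<close>. Inserting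
      \<open>N\<close> makes the maximum meaningful for empty \<open>F\<close>.\<close>
    define K where "K = Max (insert N (length ` snd ` F))"
    have K: "N \<le> K" "length v \<le> K" if "(b, v) \<in> F" for b v
      using F(1) that by (force simp: K_def intro: Max_ge)+
    have finW: "finite (W n)" for n by (simp add: W_def)
    have sub: "F \<subseteq> (\<Union>n\<in>{N..K}. {0, 1} \<times> W n)"
    proof
      fix j assume "j \<in> F"
      moreover from this obtain b v n where j: "j = (b, v)" "b \<in> {0, 1}" "v \<in> W n" "N \<le> n"
        using F(2) by (auto simp: J_def)
      moreover have "length v = n" using j(3) length_greedy_words by (auto simp: W_def)
      ultimately show "j \<in> (\<Union>n\<in>{N..K}. {0, 1} \<times> W n)" using K(2)[of b v] by auto
    qed
    have "(\<Sum>j\<in>F. diam_pow s (cylinder j)) \<le> (\<Sum>j\<in>(\<Union>n\<in>{N..K}. {0, 1} \<times> W n). diam_pow s (cylinder j))"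
      using sub finW by (intro sum_mono2) auto
    also have "\<dots> = (\<Sum>n\<in>{N..K}. \<Sum>j\<in>{0, 1} \<times> W n. diam_pow s (cylinder j))"
      using finW length_greedy_words by (intro sum.UNION_disjoint) (auto simp: W_def)
    also have "\<dots> = (\<Sum>n\<in>{N..K}. ennreal (2 * real (card (W n)) * (1 / \<phi> powr s) ^ n))"
    proof (rule sum.cong)
      fix n
      have "(\<Sum>j\<in>{0, 1} \<times> W n. diam_pow s (cylinder j)) = (\<Sum>j\<in>{0, 1 :: nat} \<times> W n. ennreal ((1 / \<phi> powr s) ^ n))"
        by (rule sum.cong) (auto simp: diam)
      also have "\<dots> = ennreal (\<Sum>j\<in>{0, 1 :: nat} \<times> W n. (1 / \<phi> powr s) ^ n)"
        by (rule sum_ennreal) simp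
      finally show "(\<Sum>j\<in>{0, 1} \<times> W n. diam_pow s (cylinder j)) =
          ennreal (2 * real (card (W n)) * (1 / \<phi> powr s) ^ n)"
        by (simp add: card_cartesian_product)
    qed simp
    also have "\<dots> = ennreal (\<Sum>n\<in>{N..K}. 2 * real (card (W n)) * (1 / \<phi> powr s) ^ n)"
      by (rule sum_ennreal) simp
    also have "\<dots> \<le> ennreal (2 * l * (\<rho> ^ N / (1 - \<rho>)))"
    proof (rule ennreal_leI)
      have "(\<Sum>n\<in>{N..K}. 2 * real (card (W n)) * (1 / \<phi> powr s) ^ n) \<le> (\<Sum>n\<in>{N..K}. 2 * l * \<rho> ^ n)"
      proof (rule sum_mono)
        fix n
        have "2 * real (card (W n)) * (1 / \<phi> powr s) ^ n \<le> 2 * (l * q ^ n) * (1 / \<phi> powr s) ^ n"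
          unfolding W_def q_def using card_frequent_words[OF par(1-3)]
          by (intro mult_right_mono mult_left_mono) auto
        then show "2 * real (card (W n)) * (1 / \<phi> powr s) ^ n \<le> 2 * l * \<rho> ^ n"
          by (simp add: \<rho>_def power_divide)
      qed
      also have "\<dots> = 2 * l * (\<Sum>n\<in>{N..K}. \<rho> ^ n)" by (simp add: sum_distrib_left)
      also have "\<dots> \<le> 2 * l * (\<rho> ^ N / (1 - \<rho>))"
        using par(1) \<rho> by (intro mult_left_mono) (auto simp: sum_gp divide_right_mono)
      finally show "(\<Sum>n\<in>{N..K}. 2 * real (card (W n)) * (1 / \<phi> powr s) ^ n) \<le> 2 * l * (\<rho> ^ N / (1 - \<rho>))" .
    qed
    finally show "(\<Sum>j\<in>F. diam_pow s (cylinder j)) \<le> ennreal (2 * l * (\<rho> ^ N / (1 - \<rho>)))" .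
  qed
  have "hausdorff_premeasure \<delta> s ?A = 0" if "0 < \<delta>" for \<delta>
  proof -
    have "(\<lambda>N. 2 * l * (\<rho> ^ N / (1 - \<rho>))) \<longlonglongrightarrow> 2 * l * (0 / (1 - \<rho>))"
      using \<rho> by (intro tendsto_intros LIMSEQ_realpow_zero) auto
    then have lim: "(\<lambda>N. ennreal (2 * l * (\<rho> ^ N / (1 - \<rho>)))) \<longlonglongrightarrow> 0"
      using tendsto_ennrealI by fastforce
    have "(\<lambda>N. (1 / \<phi>) ^ N) \<longlonglongrightarrow> 0" by (intro LIMSEQ_realpow_zero) auto
    then have "\<forall>\<^sub>F N in sequentially. (1 / \<phi>) ^ N < \<delta>" using that by (rule order_tendstoD)
    then have "\<forall>\<^sub>F N in sequentially. hausdorff_premeasure \<delta> s ?A \<le> ennreal (2 * l * (\<rho> ^ N / (1 - \<rho>)))"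
      by eventually_elim (rule pre, simp add: power_divide)
    then have "hausdorff_premeasure \<delta> s ?A \<le> 0"
      using lim by (intro tendsto_lowerbound[OF lim]) auto
    then show ?thesis by simp
  qed
  then have "hausdorff_measure s ?A = 0" unfolding hausdorff_measure_def by simp
  then show ?thesis using that s by blast
qed

theorem mainTheorem2:
  fixes \<beta> :: real
  assumes "\<beta> = (1 + sqrt 5) / 2"
  shows "mutually_singular (bernoulli_convolution \<beta>) lborel
    \<and> hausdorff_dim_measure (I_beta \<beta>) (bernoulli_convolution \<beta>)
        \<le> hausdorff_dim (digit_freq_set \<beta> (5 / 18))
    \<and> hausdorff_dim (digit_freq_set \<beta> (5 / 18)) < 1"
proof -
  have \<beta>: "\<beta> = \<phi>" using assms by (simp add: golden_def)
  let ?A = "digit_freq_set \<phi> (5 / 18)" and ?\<nu> = "bernoulli_convolution \<phi>"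
  interpret prob_space ?\<nu> by (rule prob_space_bernoulli_convolution)
  obtain s where s: "0 < s" "s < 1" "hausdorff_measure s ?A = 0"
    by (rule hausdorff_measure_digit_freq_set)
  \<comment> \<open>One set serves all claims: \<open>?A\<close> has full measure for
    \<open>?\<nu>\<close>, is Lebesgue null as its \<open>s\<close>-dimensional measure vanishes for
    some \<open>s < 1\<close>, and is a candidate in the infimum defining the dimension of
    \<open>?\<nu>\<close>.\<close>
  have "emeasure lborel ?A = 0"
    using hausdorff_null_imp_lborel_null[OF s(3)] s sets_digit_freq by simp
  moreover have "emeasure ?\<nu> (- ?A) = 0"
    using emeasure_digit_freq sets_digit_freq emeasure_compl[of ?A ?\<nu>] emeasure_space_1
    by (simp add: bernoulli_convolution_def Compl_eq_Diff_UNIV)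
  ultimately have "mutually_singular ?\<nu> lborel"
    unfolding mutually_singular_def using sets_digit_freq
    by (auto intro!: bexI[of _ "- ?A"] simp: Diff_eq)
  moreover have "hausdorff_dim_measure (I_beta \<phi>) ?\<nu> \<le> hausdorff_dim ?A"
    unfolding hausdorff_dim_measure_def
    by (rule INF_lower) (simp add: emeasure_digit_freq sets_digit_freq, simp add: digit_freq_set_def)
  moreover have "hausdorff_dim ?A \<le> ennreal s"
    unfolding hausdorff_dim_def using s by (intro INF_lower) simp
  then have "hausdorff_dim ?A < 1"
    using s by (simp add: le_less_trans)
  ultimately show ?thesis unfolding \<beta> by blast
qed

end
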